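(* Let $k$ be a field of characteristic zero and let $A=k\langle x,y\rangle/\langle x^2,\,y^2-xy\rangle$. The Koszul cohomology of $A$ is given by: 1. $HK^0(A)$ is $2$-dimensional, generated by $1$ and $xyx$; 2. $HK^1(A)$ is $2$-dimensional, generated by the classes of $x\otimes x^{\ast}+y\otimes y^{\ast}$ (which corresponds to $e_A:V\to A$, $v\mapsto v$) and $xy\otimes y^{\ast}$; 3. $HK^2(A)$ is $4$-dimensional, generated by the classes of $1\otimes x^{\ast2}$, $1\otimes y^{\ast2}$, $y\otimes y^{\ast2}$ and $xyx\otimes y^{\ast2}$; 4. for any $p\ge3$ odd (resp. even), $HK^p(A)$ is $1$-dimensional, generated by the class of $x\otimes x^{\ast p}$ (resp. $1\otimes x^{\ast p}$).
   Context: Here $A=T(V)/(R)$ with $V=k.x\oplus k.y$ and $R\subseteq V\otimes V$ spanned by $x^2=x\otimes x$ and $y^2-xy=y\otimes y-x\otimes y$. For a quadratic algebra $A=T(V)/(R)$: $W_0=k$, $W_1=V$, $W_p=\bigcap_{i+2+j=p}V^{\otimes i}\otimes R\otimes V^{\otimes j}$ for $p\ge2$ (here $W_p=k.x^p$ for $p\ge3$). Elements of $W_p$ are written $x_1\ldots x_p$ (a sum of such tensors, $x_i\in V$). Koszul cohomology $HK^\bullet(A)$ is the cohomology of $(Hom_k(W_\bullet,A),b_K)$, where for $f:W_p\to A$, $b_K(f)(x_1\ldots x_{p+1})=f(x_1\ldots x_p)x_{p+1}-(-1)^px_1f(x_2\ldots x_{p+1})$. $Hom_k(W_p,A)$ is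 identified with $A\otimes W_p^{\ast}$, where $a\otimes u$ corresponds to $w\mapsto u(w)a$. $(x^{\ast},y^{\ast})$ is the dual basis of $(x,y)$; $x^{\ast2}$ and $y^{\ast2}$ are the restrictions to $R$ of $x^{\ast}\otimes x^{\ast}$ and $y^{\ast}\otimes y^{\ast}$; for $p\ge3$, $x^{\ast p}$ is the restriction to $W_p$ of $x^{\ast\otimes p}$. *)

theory Defs
  imports
    "HOL-Library.Poly_Mapping"
    "HOL-Algebra.QuotRing"
    "Jordan_Normal_Form.VS_Connect"
begin

section \<open>The tensor algebra of a vector space with a finite basis\<close>

text \<open>
  Words over \<open>'v\<close>, written additively so that they can serve as exponents of
  \<^type>\<open>poly_mapping\<close>.  If \<open>V\<close> has basis \<open>'v\<close>, then \<open>'v fword \<Rightarrow>\<^sub>0 'k\<close> is the free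
  associative algebra on \<open>'v\<close>, i.e. the tensor algebra \<open>T(V)\<close>: the word
  \<open>[v\<^sub>1, \<dots>, v\<^sub>n]\<close> stands for \<open>v\<^sub>1 \<otimes> \<dots> \<otimes> v\<^sub>n\<close>, and the convolution product is
  concatenation of tensors.
\<close>

datatype 'v fword = FWord (letters: "'v list")

instantiation fword :: (type) monoid_add
begin

definition zero_fword :: "'a fword" where
  "0 = FWord []"

definition plus_fword :: "'a fword \<Rightarrow> 'a fword \<Rightarrow> 'a fword" where
  "u + v = FWord (letters u @ letters v)"

instance
  by standard (simp_all add: zero_fword_def plus_fword_def)

end

type_synonym ('v, 'k) tensor = "'v fword \<Rightarrow>\<^sub>0 'k"

definition tensor_algebra :: "('k :: comm_ring_1, ('v, 'k) tensor) module" where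
  "tensor_algebra =
    \<lparr>carrier = UNIV, mult = (*), one = 1, zero = 0, add = (+),
     smult = (\<lambda>c t. Poly_Mapping.single 0 c * t)\<rparr>"

abbreviation tensor_span :: "('v, 'k :: comm_ring_1) tensor set \<Rightarrow> ('v, 'k) tensor set" where
  "tensor_span S \<equiv> LinearCombinations.module.span class_ring tensor_algebra S"

definition basis_vector :: "'v \<Rightarrow> ('v, 'k :: comm_ring_1) tensor" where
  "basis_vector v = Poly_Mapping.single (FWord [v]) 1"

text \<open>\<open>tensor_power n\<close> is the component \<open>V\<^sup>\<otimes>\<^sup>n\<close> of \<open>T(V)\<close>.\<close>

definition tensor_power :: "nat \<Rightarrow> ('v, 'k :: comm_ring_1) tensor set" where
  "tensor_power n = {t. \<forall>w \<in> Poly_Mapping.keys t. length (letters w) = n}"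

text \<open>
  Every \<open>t\<close> without constant term is both \<open>\<Sum>v. strip_last v t * v\<close> and
  \<open>\<Sum>v. v * strip_first v t\<close>, where \<open>v\<close> runs over the basis.
\<close>

definition strip_last :: "'v \<Rightarrow> ('v, 'k :: comm_ring_1) tensor \<Rightarrow> ('v, 'k) tensor" where
  "strip_last v t = Poly_Mapping.map_key (\<lambda>w. w + FWord [v]) t"

definition strip_first :: "'v \<Rightarrow> ('v, 'k :: comm_ring_1) tensor \<Rightarrow> ('v, 'k) tensor" where
  "strip_first v t = Poly_Mapping.map_key (\<lambda>w. FWord [v] + w) t"

lemma lookup_strip_last:
  "Poly_Mapping.lookup (strip_last v t) w = Poly_Mapping.lookup t (w + FWord [v])"
proof -
  have "inj (\<lambda>w. w + FWord [v])"
    by (rule injI) (simp add: plus_fword_def fword.expand)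
  thus ?thesis
    by (simp add: strip_last_def map_key.rep_eq)
qed

lemma lookup_strip_first:
  "Poly_Mapping.lookup (strip_first v t) w = Poly_Mapping.lookup t (FWord [v] + w)"
proof -
  have "inj (\<lambda>w. FWord [v] + w)"
    by (rule injI) (simp add: plus_fword_def fword.expand)
  thus ?thesis
    by (simp add: strip_first_def map_key.rep_eq)
qed

lemma tensor_induct [case_names single sum]:
  fixes t :: "('v, 'k :: comm_ring_1) tensor"
  assumes single: "\<And>w c. P (Poly_Mapping.single w c)"
    and sum: "\<And>f g. P f \<Longrightarrow> P g \<Longrightarrow> P (f + g)"
  shows "P t"
proof (induction t rule: update_induct)
  case const
  show ?case
    using single[of 0 0] by simp
next
  case (update f a b)
  have "Poly_Mapping.update a b f = f + Poly_Mapping.single a b"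
    using update(1)
    by (intro poly_mapping_eqI) (auto simp: lookup_update lookup_add lookup_single when_def in_keys_iff)
  thus ?case
    using sum[OF update(3) single] by simp
qed

lemma strip_last_sum:
  fixes t :: "('v :: finite, 'k :: comm_ring_1) tensor"
  shows "t = Poly_Mapping.single 0 (Poly_Mapping.lookup t 0)
           + (\<Sum>v\<in>UNIV. strip_last v t * basis_vector v)"
proof (induction t rule: tensor_induct)
  case (single w c)
  show ?case
  proof (cases "letters w" rule: rev_cases)
    case Nil
    hence w: "w = 0"
      by (simp add: zero_fword_def fword.expand)
    have "strip_last v (Poly_Mapping.single w c) = 0" for v
      by (rule poly_mapping_eqI)
        (simp add: lookup_strip_last lookup_single w zero_fword_def plus_fword_def)
    thus ?thesis
      by (simp add: w)
  next
    case (snoc us u)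
    hence w: "w = FWord us + FWord [u]"
      by (cases w) (simp add: plus_fword_def)
    have "strip_last v (Poly_Mapping.single w c) =
            (if v = u then Poly_Mapping.single (FWord us) c else 0)" for v
      by (rule poly_mapping_eqI)
        (auto simp: lookup_strip_last lookup_single w plus_fword_def when_def fword.expand)
    hence "(\<Sum>v\<in>UNIV. strip_last v (Poly_Mapping.single w c) * basis_vector v) =
        (\<Sum>v\<in>UNIV. if v = u then Poly_Mapping.single (FWord us) c * basis_vector u else 0)"
      by (intro sum.cong) auto
    also have "\<dots> = Poly_Mapping.single w c"
      by (simp add: basis_vector_def mult_single w)
    finally show ?thesis
      by (simp add: lookup_single w zero_fword_def plus_fword_def)
  qed
next
  case (sum f g)
  have "strip_last v (f + g) = strip_last v f + strip_last v g" for v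
    by (rule poly_mapping_eqI) (simp add: lookup_strip_last lookup_add)
  thus ?case
    using sum by (simp add: lookup_add single_add distrib_right sum.distrib algebra_simps)
qed

lemma strip_first_sum:
  fixes t :: "('v :: finite, 'k :: comm_ring_1) tensor"
  shows "t = Poly_Mapping.single 0 (Poly_Mapping.lookup t 0)
           + (\<Sum>v\<in>UNIV. basis_vector v * strip_first v t)"
proof (induction t rule: tensor_induct)
  case (single w c)
  show ?case
  proof (cases "letters w")
    case Nil
    hence w: "w = 0"
      by (simp add: zero_fword_def fword.expand)
    have "strip_first v (Poly_Mapping.single w c) = 0" for v
      by (rule poly_mapping_eqI)
        (simp add: lookup_strip_first lookup_single w zero_fword_def plus_fword_def)
    thus ?thesis
      by (simp add: w)
  next
    case (Cons u us)
    hence w: "w = FWord [u] + FWord us"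
      by (cases w) (simp add: plus_fword_def)
    have "strip_first v (Poly_Mapping.single w c) =
            (if v = u then Poly_Mapping.single (FWord us) c else 0)" for v
      by (rule poly_mapping_eqI)
        (auto simp: lookup_strip_first lookup_single w plus_fword_def when_def fword.expand)
    hence "(\<Sum>v\<in>UNIV. basis_vector v * strip_first v (Poly_Mapping.single w c)) =
        (\<Sum>v\<in>UNIV. if v = u then basis_vector u * Poly_Mapping.single (FWord us) c else 0)"
      by (intro sum.cong) auto
    also have "\<dots> = Poly_Mapping.single w c"
      by (simp add: basis_vector_def mult_single w)
    finally show ?thesis
      by (simp add: lookup_single w zero_fword_def plus_fword_def)
  qed
next
  case (sum f g)
  have "strip_first v (f + g) = strip_first v f + strip_first v g" for v
    by (rule poly_mapping_eqI) (simp add: lookup_strip_first lookup_add)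
  thus ?case
    using sum by (simp add: lookup_add single_add distrib_left sum.distrib algebra_simps)
qed

text \<open>
  \<open>dual_word [v\<^sub>1, \<dots>, v\<^sub>p]\<close> is \<open>v\<^sub>1\<^sup>* \<otimes> \<dots> \<otimes> v\<^sub>p\<^sup>*\<close>, where \<open>v\<^sub>i\<^sup>*\<close> belongs to the dual basis.
\<close>

definition dual_word :: "'v list \<Rightarrow> ('v, 'k :: comm_ring_1) tensor \<Rightarrow> 'k" where
  "dual_word vs t = Poly_Mapping.lookup t (FWord vs)"


section \<open>Quadratic algebras and Koszul cohomology\<close>

text \<open>\<open>R\<close> is always a subspace of \<open>V \<otimes> V\<close>.\<close>

definition relation_ideal :: "('v, 'k :: comm_ring_1) tensor set \<Rightarrow> ('v, 'k) tensor set" where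
  "relation_ideal R = genideal tensor_algebra R"

definition quot_class :: "('v, 'k :: comm_ring_1) tensor set \<Rightarrow> ('v, 'k) tensor
    \<Rightarrow> ('v, 'k) tensor set" where
  "quot_class R t = relation_ideal R +>\<^bsub>tensor_algebra\<^esub> t"

definition quadratic_algebra :: "('v, 'k :: comm_ring_1) tensor set
    \<Rightarrow> ('k, ('v, 'k) tensor set) module" where
  "quadratic_algebra R =
    ring.extend (tensor_algebra Quot relation_ideal R)
      (module.fields (\<lambda>c X. quot_class R (Poly_Mapping.single 0 c)
         \<otimes>\<^bsub>tensor_algebra Quot relation_ideal R\<^esub> X))"

definition koszul_W :: "('v, 'k :: comm_ring_1) tensor set \<Rightarrow> nat \<Rightarrow> ('v, 'k) tensor set" where
  "koszul_W R p =
    (if p < 2 then tensor_power p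
     else \<Inter> {tensor_span {a * r * b | a r b.
               a \<in> tensor_power i \<and> r \<in> R \<and> b \<in> tensor_power j} | i j. i + 2 + j = p})"

text \<open>
  \<open>Hom\<^sub>k(W\<^sub>p, A)\<close>.  Functions are \<^const>\<open>undefined\<close> outside \<open>W\<^sub>p\<close>, so that equality of
  cochains is equality on \<open>W\<^sub>p\<close>.  The fields \<open>mult\<close> and \<open>one\<close> of the module record have no meaning.
\<close>

definition koszul_cochains :: "('v, 'k :: comm_ring_1) tensor set \<Rightarrow> nat
    \<Rightarrow> ('k, ('v, 'k) tensor \<Rightarrow> ('v, 'k) tensor set) module" where
  "koszul_cochains R p =
    (let W = koszul_W R p; A = quadratic_algebra R; Z = (\<lambda>w\<in>W. \<zero>\<^bsub>A\<^esub>)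
     in \<lparr>carrier = LinearCombinations.module_hom class_ring (tensor_algebra\<lparr>carrier := W\<rparr>) A
                    \<inter> extensional W,
         mult = (\<lambda>_ _. Z), one = Z, zero = Z,
         add = (\<lambda>f g. \<lambda>w\<in>W. f w \<oplus>\<^bsub>A\<^esub> g w),
         smult = (\<lambda>c f. \<lambda>w\<in>W. c \<odot>\<^bsub>A\<^esub> f w)\<rparr>)"

text \<open>
  The differential
  \<open>b\<^sub>K(f)(x\<^sub>1\<dots>x\<^sub>p\<^sub>+\<^sub>1) = f(x\<^sub>1\<dots>x\<^sub>p) x\<^sub>p\<^sub>+\<^sub>1 - (-1)\<^sup>p x\<^sub>1 f(x\<^sub>2\<dots>x\<^sub>p\<^sub>+\<^sub>1)\<close>.
  For the first term \<open>w \<in> W\<^sub>p\<^sub>+\<^sub>1 \<subseteq> W\<^sub>p \<otimes> V\<close> is written as \<open>\<Sum>v. strip_last v w * v\<close>, for the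
  second one \<open>w \<in> W\<^sub>p\<^sub>+\<^sub>1 \<subseteq> V \<otimes> W\<^sub>p\<close> is written as \<open>\<Sum>v. v * strip_first v w\<close>.
\<close>

definition koszul_diff :: "('v :: finite, 'k :: comm_ring_1) tensor set \<Rightarrow> nat
    \<Rightarrow> (('v, 'k) tensor \<Rightarrow> ('v, 'k) tensor set) \<Rightarrow> ('v, 'k) tensor \<Rightarrow> ('v, 'k) tensor set" where
  "koszul_diff R p f =
    (let A = quadratic_algebra R
     in (\<lambda>w \<in> koszul_W R (Suc p).
       (\<Oplus>\<^bsub>A\<^esub> v \<in> UNIV. f (strip_last v w) \<otimes>\<^bsub>A\<^esub> quot_class R (basis_vector v))
       \<ominus>\<^bsub>A\<^esub> ((- 1) ^ p \<odot>\<^bsub>A\<^esub>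
          (\<Oplus>\<^bsub>A\<^esub> v \<in> UNIV. quot_class R (basis_vector v) \<otimes>\<^bsub>A\<^esub> f (strip_first v w)))))"

definition koszul_cocycles :: "('v :: finite, 'k :: comm_ring_1) tensor set \<Rightarrow> nat
    \<Rightarrow> (('v, 'k) tensor \<Rightarrow> ('v, 'k) tensor set) set" where
  "koszul_cocycles R p =
    {f \<in> carrier (koszul_cochains R p). koszul_diff R p f = \<zero>\<^bsub>koszul_cochains R (Suc p)\<^esub>}"

definition koszul_coboundaries :: "('v :: finite, 'k :: comm_ring_1) tensor set \<Rightarrow> nat
    \<Rightarrow> (('v, 'k) tensor \<Rightarrow> ('v, 'k) tensor set) set" where
  "koszul_coboundaries R p =
    (case p of
       0 \<Rightarrow> {\<zero>\<^bsub>koszul_cochains R 0\<^esub>}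
     | Suc q \<Rightarrow> koszul_diff R q ` carrier (koszul_cochains R q))"

text \<open>The quotient of a module by a submodule, as a module of cosets; \<open>mult\<close> and \<open>one\<close> have
  no meaning.\<close>

definition quotient_module :: "('a, 'b, 'm) module_scheme \<Rightarrow> 'b set \<Rightarrow> ('a, 'b set) module" where
  "quotient_module M N =
    \<lparr>carrier = a_rcosets\<^bsub>M\<^esub> N, mult = (\<lambda>_ _. N), one = N, zero = N, add = set_add M,
     smult = (\<lambda>c X. \<Union>x\<in>X. N +>\<^bsub>M\<^esub> (c \<odot>\<^bsub>M\<^esub> x))\<rparr>"

definition HK :: "('v :: finite, 'k :: comm_ring_1) tensor set \<Rightarrow> nat
    \<Rightarrow> ('k, (('v, 'k) tensor \<Rightarrow> ('v, 'k) tensor set) set) module" where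
  "HK R p = quotient_module ((koszul_cochains R p)\<lparr>carrier := koszul_cocycles R p\<rparr>)
              (koszul_coboundaries R p)"

definition HK_class :: "('v :: finite, 'k :: comm_ring_1) tensor set \<Rightarrow> nat
    \<Rightarrow> (('v, 'k) tensor \<Rightarrow> ('v, 'k) tensor set) \<Rightarrow> (('v, 'k) tensor \<Rightarrow> ('v, 'k) tensor set) set" where
  "HK_class R p f = koszul_coboundaries R p +>\<^bsub>koszul_cochains R p\<^esub> f"

text \<open>
  The element of \<open>Hom\<^sub>k(W\<^sub>p, A)\<close> corresponding to \<open>a \<otimes> u \<in> A \<otimes> W\<^sub>p\<^sup>*\<close>, namely \<open>w \<mapsto> u(w) a\<close>.
  Here \<open>a\<close> is given by a representative in \<open>T(V)\<close>, and \<open>u\<close> by a form on \<open>T(V)\<close> which is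
  restricted to \<open>W\<^sub>p\<close>.
\<close>

definition cochain_tensor :: "('v, 'k :: comm_ring_1) tensor set \<Rightarrow> nat
    \<Rightarrow> ('v, 'k) tensor \<Rightarrow> (('v, 'k) tensor \<Rightarrow> 'k) \<Rightarrow> ('v, 'k) tensor \<Rightarrow> ('v, 'k) tensor set" where
  "cochain_tensor R p a u = (\<lambda>w \<in> koszul_W R p. u w \<odot>\<^bsub>quadratic_algebra R\<^esub> quot_class R a)"

definition generated_with_dim :: "('k :: field, 'b, 'm) module_scheme \<Rightarrow> nat \<Rightarrow> 'b set \<Rightarrow> bool" where
  "generated_with_dim M n S \<longleftrightarrow>
     vectorspace class_ring M \<and> vectorspace.fin_dim class_ring M \<and>
     vectorspace.dim class_ring M = n \<and>
     S \<subseteq> carrier M \<and> LinearCombinations.module.span class_ring M S = carrier M"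


section \<open>The generators \<open>x\<close> and \<open>y\<close>\<close>

datatype gen = X | Y

instance gen :: finite
proof
  have "(UNIV :: gen set) = {X, Y}"
    using gen.exhaust by auto
  thus "finite (UNIV :: gen set)"
    by (metis finite.emptyI finite.insertI)
qed

end

theory Submission
  imports Defs "HOL-Library.Product_Plus"
begin

text \<open>
  Rewriting \<open>y\<^sup>2\<close> to \<open>xy\<close> and \<open>x\<^sup>2\<close> to \<open>0\<close> makes \<open>yxy\<close> vanish, because \<open>y \<cdot> y\<^sup>2 = y\<^sup>2 \<cdot> y\<close> reads \<open>yxy = x\<^sup>2y\<close>.
  So \<open>A\<close> has the basis \<open>1, x, y, xy, yx, xyx\<close>.  Since \<open>W\<^sub>p\<close> is spanned by \<open>x\<^sup>p\<close> together with
  \<open>y\<close> if \<open>p = 1\<close> and \<open>y\<^sup>2 - xy\<close> if \<open>p = 2\<close>, a cochain is a pair of elements of \<open>A\<close>, its values on these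
  spanning elements, and the Koszul complex becomes a complex of explicit finite-dimensional spaces.
  In each degree the coboundaries are cut out from the cocycles by linear forms dual to
  the claimed generators.  From degree 3 on the differential is alternately the commutator and
  the anticommutator with \<open>x\<close>, whence the periodicity.
\<close>

text \<open>Rewriting shows only that the six monomials span \<open>A\<close>. Their independence
  comes from a model: the multiplication table prescribed by the rewriting rules is checked to be
  associative, so \<open>nf\<close> is a ring and \<open>nf_of\<close> a homomorphism from the
  tensor algebra, and the ideal of relations turns out to be its kernel. Equality in
  \<open>A\<close> thus means equality of six coefficients, and later identities are arithmetic in
  coordinates. Dimensions are found without computing ranks. If linear forms cut out the
  coboundaries and are dual to the proposed cocycles, their joint values identify the cohomology
  with \<open>k^n\<close>, and the proposed classes become the unit vectors. The work left in each
  degree is an explicit preimage for every cocycle killed by the forms. The identity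
  \<open>1x + x1 = 2x\<close> governs the differential out of odd degrees. In characteristic zero it
  keeps \<open>1\<close> from being a cocycle there, and it makes \<open>x\<close> a coboundary in
  the next degree; in degree 2 it only identifies the class of \<open>x\<close> on
  \<open>x^2\<close> with half the class of \<open>y\<close> on \<open>y^2 - xy\<close>.\<close>

section \<open>Normal forms in \<open>A\<close>\<close>

text \<open>Coordinates with respect to the basis \<open>1, x, y, xy, yx, xyx\<close>.\<close>

datatype 'k nf = NF (cone: 'k) (cx: 'k) (cy: 'k) (cxy: 'k) (cyx: 'k) (cxyx: 'k)

lemma nf_eq_iff:
  "a = b \<longleftrightarrow> cone a = cone b \<and> cx a = cx b \<and> cy a = cy b \<and> cxy a = cxy b
     \<and> cyx a = cyx b \<and> cxyx a = cxyx b"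
  using nf.expand by blast

instantiation nf :: (comm_ring_1) ring_1
begin

definition "0 = NF 0 0 0 0 0 0"
definition "1 = NF 1 0 0 0 0 0"
definition "a + b = NF (cone a + cone b) (cx a + cx b) (cy a + cy b) (cxy a + cxy b)
  (cyx a + cyx b) (cxyx a + cxyx b)"
definition "a - b = NF (cone a - cone b) (cx a - cx b) (cy a - cy b) (cxy a - cxy b)
  (cyx a - cyx b) (cxyx a - cxyx b)"
definition "- a = NF (- cone a) (- cx a) (- cy a) (- cxy a) (- cyx a) (- cxyx a)"
text \<open>The table follows from \<open>x^2 = 0\<close>, \<open>y^2 = xy\<close> and
  \<open>yxy = 0\<close>. The last summands for \<open>xy\<close> and \<open>xyx\<close> are the
  rewritten products \<open>y * y\<close> and \<open>y * yx\<close>; everything of degree 4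
  vanishes.\<close>

definition "a * b = NF
  (cone a * cone b)
  (cone a * cx b + cx a * cone b)
  (cone a * cy b + cy a * cone b)
  (cone a * cxy b + cxy a * cone b + cx a * cy b + cy a * cy b)
  (cone a * cyx b + cyx a * cone b + cy a * cx b)
  (cone a * cxyx b + cxyx a * cone b + cx a * cyx b + cxy a * cx b + cy a * cyx b)"

text \<open>The associativity verified here replaces the resolution of overlaps between rewriting
  rules, and is the source of the linear independence of the six monomials in
  \<open>A\<close>.\<close>

instance
  by standard
    (simp_all add: nf_eq_iff zero_nf_def one_nf_def plus_nf_def minus_nf_def uminus_nf_def
      times_nf_def algebra_simps)

end

lemma nf_sel [simp]:
  "cone 0 = 0" "cx 0 = 0" "cy 0 = 0" "cxy 0 = 0" "cyx 0 = 0" "cxyx 0 = 0"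
  "cone 1 = 1" "cx 1 = 0" "cy 1 = 0" "cxy 1 = 0" "cyx 1 = 0" "cxyx 1 = 0"
  "cone (a + b) = cone a + cone b" "cx (a + b) = cx a + cx b" "cy (a + b) = cy a + cy b"
  "cxy (a + b) = cxy a + cxy b" "cyx (a + b) = cyx a + cyx b" "cxyx (a + b) = cxyx a + cxyx b"
  "cone (a - b) = cone a - cone b" "cx (a - b) = cx a - cx b" "cy (a - b) = cy a - cy b"
  "cxy (a - b) = cxy a - cxy b" "cyx (a - b) = cyx a - cyx b" "cxyx (a - b) = cxyx a - cxyx b"
  "cone (- a) = - cone a" "cx (- a) = - cx a" "cy (- a) = - cy a"
  "cxy (- a) = - cxy a" "cyx (- a) = - cyx a" "cxyx (- a) = - cxyx a"
  "cone (a * b) = cone a * cone b"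
  "cx (a * b) = cone a * cx b + cx a * cone b"
  "cy (a * b) = cone a * cy b + cy a * cone b"
  "cxy (a * b) = cone a * cxy b + cxy a * cone b + cx a * cy b + cy a * cy b"
  "cyx (a * b) = cone a * cyx b + cyx a * cone b + cy a * cx b"
  "cxyx (a * b) = cone a * cxyx b + cxyx a * cone b + cx a * cyx b + cxy a * cx b + cy a * cyx b"
  for a b :: "'k :: comm_ring_1 nf"
  by (simp_all add: zero_nf_def one_nf_def plus_nf_def minus_nf_def uminus_nf_def times_nf_def)

definition nf_scale :: "'k :: comm_ring_1 \<Rightarrow> 'k nf \<Rightarrow> 'k nf" where
  "nf_scale c a = NF (c * cone a) (c * cx a) (c * cy a) (c * cxy a) (c * cyx a) (c * cxyx a)"

lemma nf_scale_sel [simp]: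
  "cone (nf_scale c a) = c * cone a" "cx (nf_scale c a) = c * cx a" "cy (nf_scale c a) = c * cy a"
  "cxy (nf_scale c a) = c * cxy a" "cyx (nf_scale c a) = c * cyx a"
  "cxyx (nf_scale c a) = c * cxyx a"
  by (simp_all add: nf_scale_def)

lemma nf_scale_simps [simp]:
  "nf_scale 0 a = 0" "nf_scale c 0 = 0" "nf_scale 1 a = a" "nf_scale (- 1) a = - a"
  by (simp_all add: nf_eq_iff)

lemma nf_scale_add:
  "nf_scale (c + d) a = nf_scale c a + nf_scale d a"
  "nf_scale c (a + b) = nf_scale c a + nf_scale c b"
  by (simp_all add: nf_eq_iff algebra_simps)

lemma nf_scale_scale: "nf_scale c (nf_scale d a) = nf_scale (c * d) a"
  by (simp add: nf_eq_iff algebra_simps)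

lemma nf_scale_mult:
  "nf_scale c a * nf_scale d b = nf_scale (c * d) (a * b)"
  by (simp add: nf_eq_iff algebra_simps)

primrec gen_nf :: "gen \<Rightarrow> 'k :: comm_ring_1 nf" where
  "gen_nf X = NF 0 1 0 0 0 0"
| "gen_nf Y = NF 0 0 1 0 0 0"

definition word_nf :: "gen fword \<Rightarrow> 'k :: comm_ring_1 nf" where
  "word_nf w = prod_list (map gen_nf (letters w))"

lemma word_nf_add: "word_nf (u + v) = word_nf u * word_nf v"
  by (simp add: word_nf_def plus_fword_def)

lemma word_nf_zero: "word_nf 0 = 1"
  by (simp add: word_nf_def zero_fword_def)

definition nf_of :: "(gen, 'k :: comm_ring_1) tensor \<Rightarrow> 'k nf" where
  "nf_of t = (\<Sum>w\<in>Poly_Mapping.keys t. nf_scale (Poly_Mapping.lookup t w) (word_nf w))"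

lemma nf_of_superset:
  assumes "finite S" "Poly_Mapping.keys t \<subseteq> S"
  shows "nf_of t = (\<Sum>w\<in>S. nf_scale (Poly_Mapping.lookup t w) (word_nf w))"
  unfolding nf_of_def using assms by (intro sum.mono_neutral_left) (auto simp: in_keys_iff)

lemma nf_of_single: "nf_of (Poly_Mapping.single w c) = nf_scale c (word_nf w)"
  by (subst nf_of_superset[of "{w}"]) auto

lemma nf_of_add: "nf_of (s + t) = nf_of s + nf_of t"
proof -
  let ?S = "Poly_Mapping.keys s \<union> Poly_Mapping.keys t"
  have "Poly_Mapping.keys (s + t) \<subseteq> ?S"
    by (rule Poly_Mapping.keys_add)
  thus ?thesis
    by (simp add: nf_of_superset[of ?S] lookup_add nf_scale_add sum.distrib)
qed

lemma nf_of_zero [simp]: "nf_of 0 = 0"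
  by (simp add: nf_of_def)

lemma nf_of_uminus: "nf_of (- t) = - nf_of t"
  using nf_of_add[of "- t" t] by (simp add: eq_neg_iff_add_eq_0)

lemma nf_of_diff: "nf_of (s - t) = nf_of s - nf_of t"
  using nf_of_add[of s "- t"] by (simp add: nf_of_uminus)

lemma nf_of_mult: "nf_of (s * t) = nf_of s * nf_of t"
proof (induction s rule: tensor_induct)
  case (single u c)
  show ?case
    by (induction t rule: tensor_induct)
      (simp_all add: mult_single nf_of_single word_nf_add nf_scale_mult nf_of_add distrib_left)
next
  case (sum f g)
  thus ?case
    by (simp add: nf_of_add distrib_right)
qed

lemma nf_of_basis_vector [simp]: "nf_of (basis_vector v) = gen_nf v"
  by (simp add: basis_vector_def nf_of_single word_nf_def)

lemma nf_of_one [simp]: "nf_of 1 = 1"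
  using nf_of_single[of 0 1] by (simp add: word_nf_zero)

abbreviation const :: "'k :: comm_ring_1 \<Rightarrow> ('v, 'k) tensor" where
  "const c \<equiv> Poly_Mapping.single 0 c"

lemma nf_of_const_mult: "nf_of (const c * t) = nf_scale c (nf_of t)"
  by (simp add: nf_of_mult nf_of_single word_nf_zero nf_eq_iff)

lemma const_commute: "t * const c = const c * t"
  by (induction t rule: tensor_induct) (simp_all add: mult_single algebra_simps)

lemma const_left_commute: "s * (const c * t) = const c * (s * t)"
  by (metis const_commute mult.assoc)

lemma const_simps [simp]: "const 1 = 1" "const (- c) = - const c"
  by (simp_all add: single_uminus)

abbreviation x_gen :: "(gen, 'k :: comm_ring_1) tensor" where "x_gen \<equiv> basis_vector X"
abbreviation y_gen :: "(gen, 'k :: comm_ring_1) tensor" where "y_gen \<equiv> basis_vector Y"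

definition nf_rep :: "'k :: comm_ring_1 nf \<Rightarrow> (gen, 'k) tensor" where
  "nf_rep a = const (cone a) + const (cx a) * x_gen + const (cy a) * y_gen
     + const (cxy a) * (x_gen * y_gen) + const (cyx a) * (y_gen * x_gen)
     + const (cxyx a) * (x_gen * y_gen * x_gen)"

lemma nf_of_rep [simp]: "nf_of (nf_rep a) = a"
  by (simp add: nf_rep_def nf_of_add nf_of_const_mult nf_of_mult nf_eq_iff nf_of_single word_nf_zero)

lemma nf_rep_add: "nf_rep (a + b) = nf_rep a + nf_rep b"
  by (simp add: nf_rep_def single_add algebra_simps)

section \<open>Spans in the tensor algebra\<close>

lemma tensor_algebra_simps [simp]:
  "carrier tensor_algebra = UNIV" "mult tensor_algebra = (*)" "one tensor_algebra = 1"
  "zero tensor_algebra = 0" "add tensor_algebra = (+)"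
  "smult tensor_algebra = (\<lambda>c t. Poly_Mapping.single 0 c * t)"
  by (simp_all add: tensor_algebra_def)

lemma cring_class_ring: "cring (class_ring :: 'k :: comm_ring_1 ring)"
  by unfold_locales
    (auto simp: algebra_simps Units_def intro: exI[of _ "- x" for x])

lemma ring_tensor_algebra: "ring (tensor_algebra :: ('k :: comm_ring_1, ('v, 'k) tensor) module)"
  by unfold_locales (auto simp: algebra_simps Units_def intro: exI[of _ "- x" for x])

lemma module_tensor_algebra:
  "Module.module class_ring (tensor_algebra :: ('k :: comm_ring_1, ('v, 'k) tensor) module)"
proof (intro Module.module.intro Module.module_axioms.intro)
  show "cring (class_ring :: 'k ring)" by (rule cring_class_ring)
  interpret ring "tensor_algebra :: ('k :: comm_ring_1, ('v, 'k) tensor) module"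
    by (rule ring_tensor_algebra)
  show "abelian_group (tensor_algebra :: ('k :: comm_ring_1, ('v, 'k) tensor) module)"
    by unfold_locales
qed (auto simp: algebra_simps single_add mult_single mult.assoc[symmetric])

lemma tensor_span_least:
  fixes S N :: "('v, 'k :: comm_ring_1) tensor set"
  assumes "S \<subseteq> N" "0 \<in> N" "\<And>s t. s \<in> N \<Longrightarrow> t \<in> N \<Longrightarrow> s + t \<in> N"
    "\<And>c t. t \<in> N \<Longrightarrow> const c * t \<in> N"
  shows "tensor_span S \<subseteq> N"
proof -
  interpret Module.module "class_ring :: 'k ring" "tensor_algebra :: ('k, ('v, 'k) tensor) module"
    by (rule module_tensor_algebra)
  have "submodule class_ring N tensor_algebra"
    using assms module_tensor_algebra by (auto simp: submodule_def)
  thus ?thesis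
    using span_is_subset assms by blast
qed

lemma tensor_span_closed:
  fixes S :: "('v, 'k :: comm_ring_1) tensor set"
  shows "S \<subseteq> tensor_span S" "0 \<in> tensor_span S"
    "s \<in> tensor_span S \<Longrightarrow> t \<in> tensor_span S \<Longrightarrow> s + t \<in> tensor_span S"
    "t \<in> tensor_span S \<Longrightarrow> const c * t \<in> tensor_span S"
proof -
  interpret Module.module "class_ring :: 'k ring" "tensor_algebra :: ('k, ('v, 'k) tensor) module"
    by (rule module_tensor_algebra)
  have sub: "submodule class_ring (tensor_span S) tensor_algebra"
    by (rule span_is_submodule) simp
  show "S \<subseteq> tensor_span S" by (rule in_own_span) simp
  show "0 \<in> tensor_span S" using sub by (auto simp: submodule_def)
  show "s \<in> tensor_span S \<Longrightarrow> t \<in> tensor_span S \<Longrightarrow> s + t \<in> tensor_span S"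
    using sub by (auto simp: submodule_def)
  show "t \<in> tensor_span S \<Longrightarrow> const c * t \<in> tensor_span S"
    using sub by (auto simp: submodule_def)
qed

section \<open>The relations and the ideal they generate\<close>

abbreviation yy_rel :: "(gen, 'k :: comm_ring_1) tensor" where
  "yy_rel \<equiv> y_gen * y_gen - x_gen * y_gen"

abbreviation rel :: "(gen, 'k :: comm_ring_1) tensor set" where
  "rel \<equiv> tensor_span {x_gen * x_gen, yy_rel}"

lemma rel_eq:
  "(rel :: (gen, 'k :: comm_ring_1) tensor set) =
     {const a * (x_gen * x_gen) + const b * yy_rel | a b. True}" (is "_ = ?N")
proof
  show "rel \<subseteq> ?N"
  proof (rule tensor_span_least)
    have "x_gen * x_gen = const 1 * (x_gen * x_gen) + const 0 * (yy_rel :: (gen, 'k) tensor)"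
      "yy_rel = const 0 * (x_gen * x_gen) + const 1 * (yy_rel :: (gen, 'k) tensor)"
      by simp_all
    thus "{x_gen * x_gen, yy_rel} \<subseteq> ?N" by blast
    have "0 = const 0 * (x_gen * x_gen) + const 0 * (yy_rel :: (gen, 'k) tensor)" by simp
    thus "0 \<in> ?N" by blast
  next
    fix s t assume "s \<in> ?N" "t \<in> ?N"
    then obtain a b c d where "s = const a * (x_gen * x_gen) + const b * yy_rel"
      "t = const c * (x_gen * x_gen) + const d * yy_rel" by blast
    hence "s + t = const (a + c) * (x_gen * x_gen) + const (b + d) * yy_rel"
      by (simp add: single_add distrib_right)
    thus "s + t \<in> ?N" by blast
  next
    fix c t assume "t \<in> ?N"
    then obtain a b where "t = const a * (x_gen * x_gen) + const b * yy_rel" by blast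
    hence "const c * t = const (c * a) * (x_gen * x_gen) + const (c * b) * yy_rel"
      by (simp add: distrib_left mult.assoc[symmetric] mult_single)
    thus "const c * t \<in> ?N" by blast
  qed
  show "?N \<subseteq> rel"
  proof
    fix t :: "(gen, 'k) tensor" assume "t \<in> ?N"
    then obtain a b where "t = const a * (x_gen * x_gen) + const b * yy_rel" by blast
    moreover have "x_gen * x_gen \<in> (rel :: (gen, 'k) tensor set)" "yy_rel \<in> (rel :: (gen, 'k) tensor set)"
      using tensor_span_closed(1)[of "{x_gen * x_gen, yy_rel :: (gen, 'k) tensor}"] by auto
    ultimately show "t \<in> rel"
      by (auto intro!: tensor_span_closed(3,4))
  qed
qed

lemma ideal_relation: "ideal (relation_ideal S) tensor_algebra"
proof -
  interpret ring tensor_algebra by (rule ring_tensor_algebra)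
  show ?thesis unfolding relation_ideal_def by (rule genideal_ideal) simp
qed

lemma relation_ideal_closed:
  "S \<subseteq> relation_ideal S" "0 \<in> relation_ideal S"
  "s \<in> relation_ideal S \<Longrightarrow> t \<in> relation_ideal S \<Longrightarrow> s + t \<in> relation_ideal S"
  "t \<in> relation_ideal S \<Longrightarrow> s * t \<in> relation_ideal S"
  "t \<in> relation_ideal S \<Longrightarrow> t * s \<in> relation_ideal S"
  "t \<in> relation_ideal S \<Longrightarrow> - t \<in> relation_ideal S"
  "s \<in> relation_ideal S \<Longrightarrow> t \<in> relation_ideal S \<Longrightarrow> s - t \<in> relation_ideal S"
proof -
  interpret ring tensor_algebra by (rule ring_tensor_algebra)
  interpret I: ideal "relation_ideal S" tensor_algebra by (rule ideal_relation)
  show "S \<subseteq> relation_ideal S"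
    unfolding relation_ideal_def by (rule genideal_self) simp
  show "0 \<in> relation_ideal S" using I.zero_closed by simp
  show add: "s + t \<in> relation_ideal S" if "s \<in> relation_ideal S" "t \<in> relation_ideal S" for s t
    using I.a_closed[OF that] by simp
  show l: "s * t \<in> relation_ideal S" if "t \<in> relation_ideal S" for s t
    using I.I_l_closed[OF that, of s] by simp
  show "t \<in> relation_ideal S \<Longrightarrow> t * s \<in> relation_ideal S"
    using I.I_r_closed[of t s] by simp
  show neg: "- t \<in> relation_ideal S" if "t \<in> relation_ideal S" for t
    using l[OF that, of "- 1"] by simp
  show "s - t \<in> relation_ideal S" if "s \<in> relation_ideal S" "t \<in> relation_ideal S"
    using add[OF that(1) neg[OF that(2)]] by simp
qed

text \<open>One rewriting step. A letter put in front of the six monomials leaves normal form only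
  in \<open>x^2\<close>, \<open>x^2y\<close>, \<open>x^2yx\<close>, or in \<open>y^2\<close>,
  \<open>yxy\<close>, \<open>y^2x\<close>, \<open>yxyx\<close>, and each of these is corrected by an
  element of the ideal.\<close>

lemma nf_rep_gen_mult:
  "basis_vector v * nf_rep a - nf_rep (gen_nf v * a) \<in> relation_ideal rel"
proof -
  let ?I = "relation_ideal rel :: (gen, 'a) tensor set"
  let ?r = "yy_rel :: (gen, 'a) tensor"
  have r: "x_gen * x_gen \<in> ?I" "?r \<in> ?I"
    using relation_ideal_closed(1)[of rel] tensor_span_closed(1)[of "{x_gen * x_gen, ?r}"] by auto
  \<comment> \<open>The overlap \<open>y^3\<close> made explicit: the first two terms leave
    \<open>yxy - xyy\<close>, the third turns \<open>xyy\<close> into \<open>xxy\<close>, the last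
    removes \<open>xxy\<close>.\<close>
  have "y_gen * (x_gen * y_gen) = ?r * y_gen - y_gen * ?r + x_gen * ?r + x_gen * x_gen * y_gen"
    by (simp add: algebra_simps)
  moreover have "?r * y_gen \<in> ?I" "y_gen * ?r \<in> ?I" "x_gen * ?r \<in> ?I" "x_gen * x_gen * y_gen \<in> ?I"
    using r by (blast intro: relation_ideal_closed(4,5))+
  ultimately have q: "y_gen * (x_gen * y_gen) \<in> ?I"
    by (metis relation_ideal_closed(3,7))
  show ?thesis
  proof (cases v)
    case X
    have "basis_vector v * nf_rep a - nf_rep (gen_nf v * a)
      = const (cx a) * (x_gen * x_gen) + const (cxy a) * ((x_gen * x_gen) * y_gen)
        + const (cxyx a) * ((x_gen * x_gen) * (y_gen * x_gen))"
      by (simp add: X nf_rep_def const_commute const_left_commute algebra_simps)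
    thus ?thesis using r by (simp only:) (blast intro: relation_ideal_closed(3-5))
  next
    case Y
    have "basis_vector v * nf_rep a - nf_rep (gen_nf v * a)
      = const (cy a) * ?r + const (cxy a) * (y_gen * (x_gen * y_gen))
        + const (cyx a) * (?r * x_gen) + const (cxyx a) * ((y_gen * (x_gen * y_gen)) * x_gen)"
      by (simp add: Y nf_rep_def const_commute const_left_commute algebra_simps)
    thus ?thesis using r q by (simp only:) (blast intro: relation_ideal_closed(3-5))
  qed
qed

text \<open>The spanning half of the normal form theorem. A word is built by prepending letters; the
  error made so far stays in the ideal under left multiplication, and \<open>nf_rep_gen_mult\<close>
  bounds the new one.\<close>

lemma diff_nf_rep_mem: "t - nf_rep (nf_of t) \<in> relation_ideal rel"
proof (induction t rule: tensor_induct)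
  case (single w c)
  have "Poly_Mapping.single (FWord l) c - nf_rep (nf_scale c (word_nf (FWord l)))
      \<in> relation_ideal rel" for l
  proof (induction l)
    case Nil
    have "Poly_Mapping.single (FWord []) c - nf_rep (nf_scale c (word_nf (FWord []))) = 0"
      by (simp add: word_nf_def nf_rep_def zero_fword_def)
    thus ?case using relation_ideal_closed(2)[of rel] by simp
  next
    case (Cons v l)
    let ?n = "nf_scale c (word_nf (FWord l)) :: 'a nf"
    have "nf_scale c (word_nf (FWord (v # l))) = gen_nf v * ?n"
      by (simp add: word_nf_def nf_eq_iff algebra_simps)
    moreover have "Poly_Mapping.single (FWord (v # l)) c
        = basis_vector v * Poly_Mapping.single (FWord l) c"
      by (simp add: basis_vector_def mult_single plus_fword_def)
    ultimately have "Poly_Mapping.single (FWord (v # l)) c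
          - nf_rep (nf_scale c (word_nf (FWord (v # l))))
        = basis_vector v * (Poly_Mapping.single (FWord l) c - nf_rep ?n)
          + (basis_vector v * nf_rep ?n - nf_rep (gen_nf v * ?n))"
      by (simp add: algebra_simps)
    thus ?case
      using Cons nf_rep_gen_mult[of v ?n] by (auto intro!: relation_ideal_closed(3,4))
  qed
  from this[of "letters w"] show ?case
    by (simp add: nf_of_single)
next
  case (sum f g)
  thus ?case
    using relation_ideal_closed(3)[OF sum] by (simp add: nf_of_add nf_rep_add algebra_simps)
qed

text \<open>The kernel of the homomorphism \<open>nf_of\<close> is an ideal containing both
  relations; conversely a tensor with normal form 0 differs from \<open>nf_rep 0 = 0\<close> by an
  element of the ideal.\<close>

lemma relation_ideal_eq: "relation_ideal rel = {t :: (gen, 'k :: comm_ring_1) tensor. nf_of t = 0}"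
proof (intro equalityI subsetI)
  interpret ring "tensor_algebra :: ('k, (gen, 'k) tensor) module" by (rule ring_tensor_algebra)
  let ?K = "{t :: (gen, 'k) tensor. nf_of t = 0}"
  have K: "ideal ?K tensor_algebra"
  proof (intro idealI ring_tensor_algebra group.subgroupI)
    show "Group.group (add_monoid (tensor_algebra :: ('k, (gen, 'k) tensor) module))"
      by (rule add.group_axioms)
    show "inv\<^bsub>add_monoid tensor_algebra\<^esub> a \<in> ?K" if "a \<in> ?K" for a
    proof -
      have "inv\<^bsub>add_monoid tensor_algebra\<^esub> a = - a"
        unfolding a_inv_def[symmetric] by (rule minus_equality) auto
      thus ?thesis using that by (simp add: nf_of_uminus)
    qed
    have "0 \<in> ?K" by simp
    thus "?K \<noteq> {}" by blast
  qed (auto simp: nf_of_add nf_of_mult)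
  have "rel \<subseteq> ?K"
    by (rule tensor_span_least) (auto simp: nf_of_add nf_of_const_mult nf_of_mult nf_of_diff nf_eq_iff)
  hence sub: "relation_ideal rel \<subseteq> ?K"
    unfolding relation_ideal_def by (rule genideal_minimal[OF K])
  fix t :: "(gen, 'k) tensor"
  show "t \<in> relation_ideal rel \<Longrightarrow> t \<in> ?K" using sub by blast
  assume "t \<in> ?K"
  hence "nf_rep (nf_of t) = 0" by (simp add: nf_rep_def)
  thus "t \<in> relation_ideal rel" using diff_nf_rep_mem[of t] by simp
qed

section \<open>Quotients described by linear forms\<close>

text \<open>
  The space is given through a parametrisation \<open>E\<close> on \<open>S\<close>, so that the linear structure of \<^term>\<open>M\<close>
  need not be known in advance; scalar multiplication of parameters is \<open>sc\<close>.
\<close>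

lemma generated_with_dim_quotient:
  fixes M :: "('k :: field, 'b, 'm) module_scheme" and E :: "'e :: ab_group_add \<Rightarrow> 'b"
    and sc :: "'k \<Rightarrow> 'e \<Rightarrow> 'e" and \<psi> :: "'e \<Rightarrow> nat \<Rightarrow> 'k"
  assumes carrier: "carrier M = E ` S"
    and S: "0 \<in> S" "\<And>s t. s \<in> S \<Longrightarrow> t \<in> S \<Longrightarrow> s + t \<in> S" "\<And>s t. s \<in> S \<Longrightarrow> t \<in> S \<Longrightarrow> s - t \<in> S"
      "\<And>c s. s \<in> S \<Longrightarrow> sc c s \<in> S"
    and inj: "inj_on E S"
    and add: "\<And>s t. s \<in> S \<Longrightarrow> t \<in> S \<Longrightarrow> E s \<oplus>\<^bsub>M\<^esub> E t = E (s + t)"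
    and smult: "\<And>c s. s \<in> S \<Longrightarrow> c \<odot>\<^bsub>M\<^esub> E s = E (sc c s)"
    and \<psi>_add: "\<And>s t i. \<psi> (s + t) i = \<psi> s i + \<psi> t i"
    and \<psi>_sc: "\<And>c s i. \<psi> (sc c s) i = c * \<psi> s i"
    and N: "N = E ` {s \<in> S. \<forall>i<n. \<psi> s i = 0}"
    and g: "\<And>i. i < n \<Longrightarrow> g i \<in> S"
    and \<psi>_g: "\<And>i j. i < n \<Longrightarrow> j < n \<Longrightarrow> \<psi> (g i) j = (if i = j then 1 else 0)"
  shows "generated_with_dim (quotient_module M N) n ((\<lambda>i. N +>\<^bsub>M\<^esub> E (g i)) ` {..<n})"
proof -
  let ?Q = "quotient_module M N"
  \<comment> \<open>The fibre over the values \<open>v\<close> of the forms. The cosets of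
    \<open>N\<close> are exactly these fibres, so the quotient is \<open>k^n\<close>; the values of
    \<open>v\<close> from \<open>n\<close> on do not affect \<open>F v\<close>.\<close>
  define F where "F v = E ` {s \<in> S. \<forall>i<n. \<psi> s i = v i}" for v
  have \<psi>_0: "\<psi> 0 i = 0" for i
    using \<psi>_add[of 0 0 i] by (metis add.right_neutral add_left_cancel)
  have \<psi>_diff: "\<psi> (s - t) i = \<psi> s i - \<psi> t i" for s t i
    using \<psi>_add[of "s - t" t i] by (simp add: algebra_simps)
  have ex: "\<exists>s\<in>S. \<forall>i<n. \<psi> s i = v i" for v
  proof -
    \<comment> \<open>Prescribed values are reached one form at a time by adding multiples of the
      dual elements \<open>g m\<close>, so no fibre is empty.\<close>
    have "m \<le> n \<Longrightarrow> \<exists>s\<in>S. \<forall>i<n. \<psi> s i = (if i < m then v i else 0)" for m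
    proof (induction m)
      case 0
      thus ?case using S(1) \<psi>_0 by auto
    next
      case (Suc m)
      then obtain s where s: "s \<in> S" "\<forall>i<n. \<psi> s i = (if i < m then v i else 0)" by auto
      have "s + sc (v m) (g m) \<in> S" using s(1) S g Suc.prems by auto
      moreover have "\<forall>i<n. \<psi> (s + sc (v m) (g m)) i = (if i < Suc m then v i else 0)"
        using s(2) Suc.prems by (auto simp: \<psi>_add \<psi>_sc \<psi>_g less_Suc_eq)
      ultimately show ?case by blast
    qed
    from this[of n] show ?thesis by simp
  qed
  have F_eq_iff: "F v = F w \<longleftrightarrow> (\<forall>i<n. v i = w i)" for v w
  proof
    assume eq: "F v = F w"
    obtain s where s: "s \<in> S" "\<forall>i<n. \<psi> s i = v i" using ex by blast
    hence "E s \<in> F w" using eq by (auto simp: F_def)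
    then obtain t where "t \<in> S" "\<forall>i<n. \<psi> t i = w i" "E s = E t" by (auto simp: F_def)
    thus "\<forall>i<n. v i = w i" using inj s by (auto dest: inj_onD)
  qed (auto simp: F_def)
  have coset: "N +>\<^bsub>M\<^esub> E s = F (\<psi> s)" if s: "s \<in> S" for s
  proof
    show "N +>\<^bsub>M\<^esub> E s \<subseteq> F (\<psi> s)"
      using s by (auto simp: a_r_coset_def r_coset_def N F_def add \<psi>_add S)
    show "F (\<psi> s) \<subseteq> N +>\<^bsub>M\<^esub> E s"
    proof
      fix z assume "z \<in> F (\<psi> s)"
      then obtain t where t: "t \<in> S" "\<forall>i<n. \<psi> t i = \<psi> s i" "z = E t" by (auto simp: F_def)
      hence "E (t - s) \<in> N" "z = E (t - s) \<oplus>\<^bsub>M\<^esub> E s"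
        using s S by (auto simp: N \<psi>_diff add)
      thus "z \<in> N +>\<^bsub>M\<^esub> E s" by (auto simp: a_r_coset_def r_coset_def)
    qed
  qed
  have Q_carrier: "carrier ?Q = range F"
  proof -
    have "carrier ?Q = (\<lambda>s. F (\<psi> s)) ` S"
      using coset by (auto simp: quotient_module_def A_RCOSETS_def' carrier)
    moreover have "F v \<in> (\<lambda>s. F (\<psi> s)) ` S" for v
    proof -
      obtain s where "s \<in> S" "\<forall>i<n. \<psi> s i = v i" using ex by blast
      moreover from this have "F v = F (\<psi> s)" by (simp add: F_eq_iff)
      ultimately show ?thesis by blast
    qed
    ultimately show ?thesis by auto
  qed
  have Q_zero: "\<zero>\<^bsub>?Q\<^esub> = F (\<lambda>_. 0)"
    by (simp add: quotient_module_def N F_def)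
  have Q_add: "F v \<oplus>\<^bsub>?Q\<^esub> F w = F (\<lambda>i. v i + w i)" for v w
  proof -
    have "F v \<oplus>\<^bsub>?Q\<^esub> F w = (\<Union>x\<in>F v. \<Union>y\<in>F w. {x \<oplus>\<^bsub>M\<^esub> y})"
      by (simp add: quotient_module_def set_add_def set_mult_def)
    also have "\<dots> = F (\<lambda>i. v i + w i)"
    proof
      show "(\<Union>x\<in>F v. \<Union>y\<in>F w. {x \<oplus>\<^bsub>M\<^esub> y}) \<subseteq> F (\<lambda>i. v i + w i)"
        by (auto simp: F_def add \<psi>_add S)
      show "F (\<lambda>i. v i + w i) \<subseteq> (\<Union>x\<in>F v. \<Union>y\<in>F w. {x \<oplus>\<^bsub>M\<^esub> y})"
      proof
        fix z assume "z \<in> F (\<lambda>i. v i + w i)"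
        then obtain t where t: "t \<in> S" "\<forall>i<n. \<psi> t i = v i + w i" "z = E t" by (auto simp: F_def)
        obtain s where s: "s \<in> S" "\<forall>i<n. \<psi> s i = v i" using ex by blast
        have "E s \<in> F v" "E (t - s) \<in> F w" "z = E s \<oplus>\<^bsub>M\<^esub> E (t - s)"
          using s t S by (auto simp: F_def \<psi>_diff add)
        thus "z \<in> (\<Union>x\<in>F v. \<Union>y\<in>F w. {x \<oplus>\<^bsub>M\<^esub> y})" by blast
      qed
    qed
    finally show ?thesis .
  qed
  have Q_smult: "c \<odot>\<^bsub>?Q\<^esub> F v = F (\<lambda>i. c * v i)" for c v
  proof -
    \<comment> \<open>Scalar multiplication of cosets is a union over representatives. All of them
      yield the same coset, and since there is one the union is that coset.\<close>
    have "N +>\<^bsub>M\<^esub> (c \<odot>\<^bsub>M\<^esub> x) = F (\<lambda>i. c * v i)" if "x \<in> F v" for x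
    proof -
      from that obtain s where s: "s \<in> S" "\<forall>i<n. \<psi> s i = v i" "x = E s" by (auto simp: F_def)
      hence "N +>\<^bsub>M\<^esub> (c \<odot>\<^bsub>M\<^esub> x) = F (\<psi> (sc c s))" by (simp add: smult coset S)
      also have "\<dots> = F (\<lambda>i. c * v i)" using s by (simp add: F_eq_iff \<psi>_sc)
      finally show ?thesis .
    qed
    moreover obtain x where "x \<in> F v" using ex[of v] by (auto simp: F_def)
    ultimately show ?thesis by (auto simp: quotient_module_def)
  qed
  have mod: "Module.module class_ring ?Q"
  proof (rule module_criteria)
    show "\<forall>v\<in>carrier ?Q. \<exists>neg_v\<in>carrier ?Q. v \<oplus>\<^bsub>?Q\<^esub> neg_v = \<zero>\<^bsub>?Q\<^esub>"
    proof
      fix V assume "V \<in> carrier ?Q"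
      then obtain v where "V = F v" by (auto simp: Q_carrier)
      hence "V \<oplus>\<^bsub>?Q\<^esub> F (\<lambda>i. - v i) = \<zero>\<^bsub>?Q\<^esub>" by (simp add: Q_add Q_zero)
      thus "\<exists>neg_v\<in>carrier ?Q. V \<oplus>\<^bsub>?Q\<^esub> neg_v = \<zero>\<^bsub>?Q\<^esub>" by (auto simp: Q_carrier)
    qed
  qed (auto simp: Q_carrier Q_zero Q_add Q_smult cring_class_ring algebra_simps)
  interpret vectorspace class_ring ?Q
    using mod class_field by (simp add: vectorspace_def)
  \<comment> \<open>The unit vectors, which will be the classes of the \<open>g i\<close>.\<close>
  define G where "G i = F (\<lambda>j. if i = j then 1 else 0)" for i
  have G_inj: "inj_on G {..<n}"
    by (rule inj_onI) (auto simp: G_def F_eq_iff split: if_splits)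
  have G_carrier: "G ` I \<subseteq> carrier ?Q" for I
    by (auto simp: G_def Q_carrier)
  have lincomb_G: "lincomb a (G ` I) = F (\<lambda>j. if j \<in> I then a (G j) else 0)"
    if "I \<subseteq> {..<n}" for a I
  proof -
    have "finite I" using that finite_subset by blast
    thus ?thesis using that
    proof (induction I rule: finite_induct)
      case empty
      show ?case by (simp add: lincomb_def Q_zero)
    next
      case (insert i I)
      have "G i \<notin> G ` I"
        using insert.hyps insert.prems inj_on_image_mem_iff[OF G_inj, of i I] by auto
      hence "lincomb a (G ` insert i I) = a (G i) \<odot>\<^bsub>?Q\<^esub> G i \<oplus>\<^bsub>?Q\<^esub> lincomb a (G ` I)"
        using lincomb_insert[of "G ` I" a "G i"] insert.hyps G_carrier[of "insert i I"] by auto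
      also have "\<dots> = F (\<lambda>j. if j \<in> insert i I then a (G j) else 0)"
        using insert.IH insert.prems insert.hyps
        by (auto simp: G_def[of i] Q_smult Q_add F_eq_iff)
      finally show ?case .
    qed
  qed
  have B: "basis (G ` {..<n})"
    unfolding basis_def
  proof (intro conjI G_carrier)
    show "lin_indpt (G ` {..<n})"
    proof (rule finite_lin_indpt2)
      fix a assume "lincomb a (G ` {..<n}) = \<zero>\<^bsub>?Q\<^esub>"
      thus "\<forall>v\<in>G ` {..<n}. a v = \<zero>\<^bsub>class_ring\<^esub>"
        by (auto simp: lincomb_G Q_zero F_eq_iff)
    qed (auto simp: G_carrier)
    show "span (G ` {..<n}) = carrier ?Q"
    proof
      show "span (G ` {..<n}) \<subseteq> carrier ?Q"
        using span_is_subset2[OF G_carrier] .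
      show "carrier ?Q \<subseteq> span (G ` {..<n})"
      proof
        fix V assume "V \<in> carrier ?Q"
        then obtain v where v: "V = F v" by (auto simp: Q_carrier)
        \<comment> \<open>Coefficients of \<open>lincomb\<close> are indexed by vectors, so the
          index has to be recovered from \<open>G i\<close>.\<close>
        have "V = lincomb (\<lambda>x. v (the_inv_into {..<n} G x)) (G ` {..<n})"
          by (auto simp: v lincomb_G F_eq_iff the_inv_into_f_f[OF G_inj])
        thus "V \<in> span (G ` {..<n})" by (auto simp: finite_span G_carrier)
      qed
    qed
  qed
  have "(\<lambda>i. N +>\<^bsub>M\<^esub> E (g i)) ` {..<n} = G ` {..<n}"
    by (rule image_cong) (auto simp: coset g G_def F_eq_iff \<psi>_g)
  moreover have "dim = n"
    using dim_basis[OF _ B] card_image[OF G_inj] by simp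
  moreover have "fin_dim"
    unfolding fin_dim_def using B by (auto simp: basis_def)
  ultimately show ?thesis
    unfolding generated_with_dim_def using B vectorspace_axioms by (auto simp: basis_def)
qed

section \<open>The quadratic algebra\<close>

text \<open>The elements of the quotient ring are sets of tensors. As the ideal is the kernel of
  \<open>nf_of\<close>, its cosets are the fibres of \<open>nf_of\<close>.\<close>

definition nf_class :: "'k :: comm_ring_1 nf \<Rightarrow> (gen, 'k) tensor set" where
  "nf_class a = {t. nf_of t = a}"

lemma nf_class_eq_iff [simp]: "nf_class a = nf_class b \<longleftrightarrow> a = b"
proof
  assume "nf_class a = nf_class b"
  hence "nf_rep a \<in> nf_class b" by (metis (mono_tags) mem_Collect_eq nf_class_def nf_of_rep)
  thus "a = b" by (simp add: nf_class_def)
qed simp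

lemma quot_class_rel: "quot_class rel t = nf_class (nf_of t)"
proof -
  have "s \<in> quot_class rel t" if "nf_of s = nf_of t" for s
  proof -
    have "s - t \<in> relation_ideal rel" using that by (simp add: relation_ideal_eq nf_of_diff)
    thus ?thesis by (force simp: quot_class_def a_r_coset_def r_coset_def)
  qed
  thus ?thesis
    by (auto simp: quot_class_def a_r_coset_def r_coset_def nf_class_def relation_ideal_eq nf_of_add)
qed

abbreviation alg :: "('k :: comm_ring_1, (gen, 'k) tensor set) module" where
  "alg \<equiv> quadratic_algebra rel"

lemma alg_simps [simp]:
  "carrier alg = range (nf_class :: 'k nf \<Rightarrow> _)"
  "\<zero>\<^bsub>alg\<^esub> = nf_class (0 :: 'k nf)" "\<one>\<^bsub>alg\<^esub> = nf_class (1 :: 'k nf)"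
  "nf_class a \<oplus>\<^bsub>alg\<^esub> nf_class b = nf_class (a + b)"
  "nf_class a \<otimes>\<^bsub>alg\<^esub> nf_class b = nf_class (a * b)"
  "c \<odot>\<^bsub>alg\<^esub> nf_class a = nf_class (nf_scale c a)"
  for a b :: "'k :: comm_ring_1 nf"
proof -
  let ?T = "tensor_algebra :: ('k, (gen, 'k) tensor) module"
  let ?Q = "?T Quot relation_ideal rel"
  interpret I: ideal "relation_ideal rel" ?T by (rule ideal_relation)
  note qc = quot_class_def[symmetric]
  have hom: "(+>\<^bsub>?T\<^esub>) (relation_ideal rel) \<in> Ring.ring_hom ?T ?Q" by (rule I.rcos_ring_hom)
  have mult: "nf_class a \<otimes>\<^bsub>?Q\<^esub> nf_class b = nf_class (a * b)" for a b
    using ring_hom_mult[OF hom, of "nf_rep a" "nf_rep b"]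
    by (simp add: qc quot_class_rel nf_of_mult)
  have add: "nf_class a \<oplus>\<^bsub>?Q\<^esub> nf_class b = nf_class (a + b)" for a b
    using ring_hom_add[OF hom, of "nf_rep a" "nf_rep b"]
    by (simp add: qc quot_class_rel nf_of_add)
  have "carrier ?Q = range (quot_class rel)"
    by (auto simp: FactRing_def A_RCOSETS_def RCOSETS_def quot_class_def a_r_coset_def)
  also have "\<dots> = range nf_class"
    by (auto simp: quot_class_rel) (metis nf_of_rep rangeI)
  finally have car: "carrier ?Q = range nf_class" .
  note alg_def = quadratic_algebra_def ring.defs module.defs
  show "carrier alg = range (nf_class :: 'k nf \<Rightarrow> _)" using car by (simp add: alg_def)
  show "\<zero>\<^bsub>alg\<^esub> = nf_class (0 :: 'k nf)"
    by (simp add: alg_def FactRing_def relation_ideal_eq nf_class_def)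
  show "\<one>\<^bsub>alg\<^esub> = nf_class (1 :: 'k nf)"
    using ring_hom_one[OF hom] by (simp add: alg_def qc quot_class_rel)
  show "nf_class a \<oplus>\<^bsub>alg\<^esub> nf_class b = nf_class (a + b)" using add by (simp add: alg_def)
  show "nf_class a \<otimes>\<^bsub>alg\<^esub> nf_class b = nf_class (a * b)" using mult by (simp add: alg_def)
  have "nf_of (const c) * a = nf_scale c a" 
    by (simp add: nf_of_single word_nf_zero nf_eq_iff)
  thus "c \<odot>\<^bsub>alg\<^esub> nf_class a = nf_class (nf_scale c a)"
    using mult by (simp add: alg_def quot_class_rel)
qed

lemma ring_alg: "ring (alg :: ('k :: comm_ring_1, (gen, 'k) tensor set) module)"
proof (intro ringI abelian_groupI monoidI)
  fix V :: "(gen, 'k) tensor set"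
  assume "V \<in> carrier alg"
  then obtain v where "V = nf_class v" by auto
  hence "nf_class (- v) \<oplus>\<^bsub>alg\<^esub> V = \<zero>\<^bsub>alg\<^esub>" by simp
  thus "\<exists>W\<in>carrier alg. W \<oplus>\<^bsub>alg\<^esub> V = \<zero>\<^bsub>alg\<^esub>" by auto
qed (auto simp: algebra_simps)

lemma alg_minus [simp]:
  "nf_class a \<ominus>\<^bsub>alg\<^esub> nf_class b = nf_class (a - b)" for a b :: "'k :: comm_ring_1 nf"
proof -
  interpret ring "alg :: ('k, (gen, 'k) tensor set) module" by (rule ring_alg)
  have "\<ominus>\<^bsub>alg\<^esub> nf_class b = nf_class (- b)"
    by (rule minus_equality) auto
  thus ?thesis by (simp add: a_minus_def)
qed

lemma UNIV_gen: "(UNIV :: gen set) = {X, Y}"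
  using gen.exhaust by auto

lemma alg_finsum_gen [simp]:
  "(\<Oplus>\<^bsub>alg\<^esub> v \<in> UNIV. nf_class (f v)) = nf_class (f X + f Y)" for f :: "gen \<Rightarrow> 'k :: comm_ring_1 nf"
proof -
  interpret ring "alg :: ('k, (gen, 'k) tensor set) module" by (rule ring_alg)
  show ?thesis by (simp add: UNIV_gen)
qed

section \<open>The spaces \<open>W\<^sub>p\<close>\<close>

lemma lookup_const_mult [simp]: "Poly_Mapping.lookup (const c * t) w = c * Poly_Mapping.lookup t w"
  by (induction t rule: tensor_induct)
    (simp_all add: mult_single lookup_single lookup_add distrib_left when_def)

lemma lookup_mult_word:
  fixes s t :: "('v, 'k :: comm_ring_1) tensor"
  shows "Poly_Mapping.lookup (s * t) (FWord l) =
     (\<Sum>k\<le>length l. Poly_Mapping.lookup s (FWord (take k l)) * Poly_Mapping.lookup t (FWord (drop k l)))"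
proof (induction s rule: tensor_induct)
  case (single u c)
  show ?case
  proof (induction t rule: tensor_induct)
    case (single w d)
    let ?n = "length (letters u)"
    \<comment> \<open>The bound on \<open>k\<close> matters: beyond the end of \<open>l\<close>,
      \<open>take k l\<close> no longer determines \<open>k\<close>.\<close>
    have iff: "u = FWord (take k l) \<and> w = FWord (drop k l) \<longleftrightarrow> u + w = FWord l \<and> k = ?n"
      if "k \<le> length l" for k
    proof -
      have "take k l = a \<and> drop k l = b \<longleftrightarrow> a @ b = l \<and> k = length a" for a b
        using that by auto
      thus ?thesis by (cases u; cases w) (auto simp: plus_fword_def)
    qed
    have "(\<Sum>k\<le>length l. Poly_Mapping.lookup (Poly_Mapping.single u c) (FWord (take k l))
        * Poly_Mapping.lookup (Poly_Mapping.single w d) (FWord (drop k l)))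
      = (\<Sum>k\<le>length l. if u = FWord (take k l) \<and> w = FWord (drop k l) then c * d else 0)"
      by (intro sum.cong refl) (simp add: lookup_single when_def)
    also have "\<dots> = (\<Sum>k\<le>length l. if k = ?n then (if u + w = FWord l then c * d else 0) else 0)"
      by (intro sum.cong refl) (simp add: iff)
    also have "\<dots> = (if u + w = FWord l then c * d else 0)"
      by (cases u; cases w) (auto simp: plus_fword_def)
    finally show ?case
      by (simp add: mult_single lookup_single when_def)
  next
    case (sum f g)
    thus ?case by (simp add: distrib_left lookup_add sum.distrib)
  qed
next
  case (sum f g)
  thus ?case by (simp add: distrib_right lookup_add sum.distrib)
qed

lemma tensor_power_lookup:
  "t \<in> tensor_power n \<Longrightarrow> length l \<noteq> n \<Longrightarrow> Poly_Mapping.lookup t (FWord l) = 0"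
  by (force simp: tensor_power_def in_keys_iff)

lemma tensor_powerI:
  "(\<And>l. length l \<noteq> n \<Longrightarrow> Poly_Mapping.lookup t (FWord l) = 0) \<Longrightarrow> t \<in> tensor_power n"
  by (auto simp: tensor_power_def in_keys_iff) (metis fword.collapse)

lemma lookup_mult_homogeneous_left:
  fixes a t :: "('v, 'k :: comm_ring_1) tensor"
  assumes "a \<in> tensor_power i"
  shows "Poly_Mapping.lookup (a * t) (FWord l) =
    (if i \<le> length l then Poly_Mapping.lookup a (FWord (take i l)) * Poly_Mapping.lookup t (FWord (drop i l))
     else 0)"
proof -
  have "Poly_Mapping.lookup (a * t) (FWord l) = (\<Sum>k\<le>length l. if k = i then
      Poly_Mapping.lookup a (FWord (take i l)) * Poly_Mapping.lookup t (FWord (drop i l)) else 0)"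
    unfolding lookup_mult_word using tensor_power_lookup[OF assms]
    by (intro sum.cong) auto
  thus ?thesis by simp
qed

lemma lookup_mult_homogeneous_right:
  fixes t b :: "('v, 'k :: comm_ring_1) tensor"
  assumes "b \<in> tensor_power j"
  shows "Poly_Mapping.lookup (t * b) (FWord l) =
    (if j \<le> length l then Poly_Mapping.lookup t (FWord (take (length l - j) l))
        * Poly_Mapping.lookup b (FWord (drop (length l - j) l))
     else 0)"
proof -
  have "Poly_Mapping.lookup (t * b) (FWord l) = (\<Sum>k\<le>length l. if k = length l - j \<and> j \<le> length l then
      Poly_Mapping.lookup t (FWord (take (length l - j) l)) * Poly_Mapping.lookup b (FWord (drop (length l - j) l)) else 0)"
    unfolding lookup_mult_word using tensor_power_lookup[OF assms]
    by (intro sum.cong) auto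
  thus ?thesis by (cases "j \<le> length l") auto
qed

lemma basis_vector_mult2: 
  "basis_vector u * basis_vector v = Poly_Mapping.single (FWord [u, v]) (1 :: 'k :: comm_ring_1)"
  by (simp add: basis_vector_def mult_single plus_fword_def)

definition W_x :: "nat \<Rightarrow> (gen, 'k :: comm_ring_1) tensor" where
  "W_x p = Poly_Mapping.single (FWord (replicate p X)) 1"

text \<open>The value 0 outside degrees 1 and 2 allows one description of
  \<open>koszul_W rel p\<close>, with two spanning elements, in all degrees.\<close>

definition W_y :: "nat \<Rightarrow> (gen, 'k :: comm_ring_1) tensor" where
  "W_y p = (if p = 1 then y_gen else if p = 2 then yy_rel else 0)"

text \<open>These are the linear equations of \<open>R\<close> inside \<open>V \<otimes> V\<close>.
  Imposed at every position of a longer word, they determine \<open>W_p\<close>.\<close>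

lemma lookup_rel:
  assumes "r \<in> rel"
  shows "Poly_Mapping.lookup r (FWord [Y, X]) = 0"
    "Poly_Mapping.lookup r (FWord [Y, Y]) = - Poly_Mapping.lookup r (FWord [X, Y])"
    "r \<in> tensor_power 2"
proof -
  from assms obtain a b where r: "r = const a * (x_gen * x_gen) + const b * yy_rel"
    unfolding rel_eq by blast
  show "Poly_Mapping.lookup r (FWord [Y, X]) = 0"
    "Poly_Mapping.lookup r (FWord [Y, Y]) = - Poly_Mapping.lookup r (FWord [X, Y])"
    by (simp_all add: r lookup_add lookup_minus basis_vector_mult2 lookup_single when_def)
  show "r \<in> tensor_power 2"
    by (rule tensor_powerI)
      (auto simp: r lookup_add lookup_minus basis_vector_mult2 lookup_single when_def)
qed

text \<open>
  \<open>f\<close> stands for the coefficients of an element of \<open>W\<^sub>p\<close>.  Up to sign, the coefficients of words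
  with a factor \<open>yyy\<close>, \<open>xyy\<close>, \<open>xxy\<close> are successively reduced to those of words with a factor \<open>yx\<close>, and
  every word of length \<open>p \<ge> 3\<close> other than \<open>x\<^sup>p\<close> contains one of these four factors.
\<close>

lemma lookup_eq_0_of_relations:
  fixes f :: "gen list \<Rightarrow> 'k :: comm_ring_1"
  assumes yx: "\<And>l r. length l + 2 + length r = p \<Longrightarrow> f (l @ Y # X # r) = 0"
    and yy: "\<And>l r. length l + 2 + length r = p \<Longrightarrow> f (l @ Y # Y # r) = - f (l @ X # Y # r)"
    and p: "p \<ge> 3" and len: "length s = p" and s: "s \<noteq> replicate p X"
  shows "f s = 0"
proof -
  have yyy: "f (l @ Y # Y # Y # r) = 0" if "length l + 3 + length r = p" for l r
    using yy[of "l @ [Y]" r] yx[of l "Y # r"] that by simp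
  have xyy: "f (l @ X # Y # Y # r) = 0" if "length l + 3 + length r = p" for l r
    using yy[of l "Y # r"] yyy[OF that] that by simp
  have xxy: "f (l @ X # X # Y # r) = 0" if "length l + 3 + length r = p" for l r
    using yy[of "l @ [X]" r] xyy[OF that] that by simp
  have "Y \<in> set s"
  proof (rule ccontr)
    assume "Y \<notin> set s"
    hence "\<forall>z\<in>set s. z = X" by (metis gen.exhaust)
    thus False using s len by (metis replicate_length_same)
  qed
  \<comment> \<open>At the first \<open>Y\<close>, only letters \<open>X\<close> precede. None
    before it gives a factor \<open>yx\<close> or \<open>yyy\<close>, exactly one gives
    \<open>yx\<close> or \<open>xyy\<close>, and two or more give \<open>xxy\<close>.\<close>
  then obtain l r where lr: "s = l @ Y # r" "Y \<notin> set l"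
    by (metis split_list_first)
  have gen: "z = X" if "z \<noteq> Y" for z using that gen.exhaust by blast
  show ?thesis
  proof (cases l rule: rev_cases)
    case Nil
    with lr len p obtain a b r' where "s = Y # a # b # r'"
      by (auto simp: Suc_le_length_iff numeral_3_eq_3)
    thus ?thesis
      using yx[of "[]" "b # r'"] yx[of "[Y]" r'] yyy[of "[]" r'] len by (cases a; cases b) auto
  next
    case (snoc l' z)
    note l1 = this
    show ?thesis
    proof (cases l' rule: rev_cases)
      case Nil
      with lr l1 len p obtain a r' where "s = X # Y # a # r'"
        using gen by (cases r) auto
      thus ?thesis
        using yx[of "[X]" r'] xyy[of "[]" r'] len by (cases a) auto
    next
      case (snoc l'' z')
      hence "s = l'' @ X # X # Y # r" using lr l1 gen by auto
      thus ?thesis using xxy[of l'' r] len by simp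
    qed
  qed
qed

lemma koszul_W_ge_3:
  assumes p: "p \<ge> 3"
  shows "koszul_W rel p = {const a * W_x p | a :: 'k :: comm_ring_1. True}"
proof
  let ?G = "\<lambda>i j. {a * r * b | a r b. a \<in> tensor_power i \<and> r \<in> rel \<and> b \<in> tensor_power j}
    :: (gen, 'k) tensor set"
  have W: "koszul_W rel p = \<Inter> {tensor_span (?G i j) | i j. i + 2 + j = p}"
    using p by (simp add: koszul_W_def)
  show "koszul_W rel p \<subseteq> {const a * W_x p | a :: 'k. True}"
  proof
    fix t :: "(gen, 'k) tensor"
    assume t: "t \<in> koszul_W rel p"
    \<comment> \<open>Homogeneity and the equations of \<open>R\<close> at position \<open>i\<close>
      are linear conditions, so it suffices to verify them on the products that span.\<close>
    have *: "(\<forall>l. length l \<noteq> p \<longrightarrow> Poly_Mapping.lookup t (FWord l) = 0) \<and>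
      (\<forall>l r. length l = i \<and> length r = j \<longrightarrow> Poly_Mapping.lookup t (FWord (l @ Y # X # r)) = 0 \<and>
         Poly_Mapping.lookup t (FWord (l @ Y # Y # r)) = - Poly_Mapping.lookup t (FWord (l @ X # Y # r)))"
      if ij: "i + 2 + j = p" for i j
    proof -
      let ?N = "{t :: (gen, 'k) tensor. (\<forall>l. length l \<noteq> p \<longrightarrow> Poly_Mapping.lookup t (FWord l) = 0) \<and>
      (\<forall>l r. length l = i \<and> length r = j \<longrightarrow> Poly_Mapping.lookup t (FWord (l @ Y # X # r)) = 0 \<and>
         Poly_Mapping.lookup t (FWord (l @ Y # Y # r)) = - Poly_Mapping.lookup t (FWord (l @ X # Y # r)))}"
      have "?G i j \<subseteq> ?N"
      proof
        fix u assume "u \<in> ?G i j"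
        then obtain a r b where u: "u = a * r * b" and a: "a \<in> tensor_power i" and r: "r \<in> rel"
          and b: "b \<in> tensor_power j" by blast
        have "Poly_Mapping.lookup u (FWord l) = 0" if "length l \<noteq> p" for l
          using that ij tensor_power_lookup[OF lookup_rel(3)[OF r]]
          by (auto simp: u lookup_mult_homogeneous_right[OF b] lookup_mult_homogeneous_left[OF a])
        thus "u \<in> ?N"
          by (simp add: u lookup_mult_homogeneous_right[OF b] lookup_mult_homogeneous_left[OF a]
              lookup_rel[OF r])
      qed
      hence "tensor_span (?G i j) \<subseteq> ?N"
        by (rule tensor_span_least) (simp_all add: lookup_add)
      moreover have "t \<in> tensor_span (?G i j)" using t ij unfolding W by blast
      ultimately show ?thesis by blast
    qed
    have "t = const (Poly_Mapping.lookup t (FWord (replicate p X))) * W_x p"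
    proof (rule poly_mapping_eqI)
      fix w :: "gen fword"
      obtain s where w: "w = FWord s" by (cases w)
      have "Poly_Mapping.lookup t (FWord s) = 0" if "s \<noteq> replicate p X"
      proof (cases "length s = p")
        case True
        show ?thesis
          by (rule lookup_eq_0_of_relations[of p "\<lambda>s. Poly_Mapping.lookup t (FWord s)" s])
            (use * p True that in blast)+
      next
        case False
        thus ?thesis using *[of "p - 2" 0] p by simp
      qed
      thus "Poly_Mapping.lookup t w = Poly_Mapping.lookup
          (const (Poly_Mapping.lookup t (FWord (replicate p X))) * W_x p) w"
        by (auto simp: w W_x_def lookup_single when_def)
    qed
    thus "t \<in> {const a * W_x p | a :: 'k. True}" by blast
  qed
  \<comment> \<open>At every position, \<open>x^p = x^i * x^2 * x^j\<close> exhibits the relation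
    \<open>x^2\<close>.\<close>
  have "W_x p \<in> tensor_span (?G i j)" if "i + 2 + j = p" for i j
  proof -
    have "W_x i \<in> tensor_power i" "W_x j \<in> tensor_power j"
      by (auto intro!: tensor_powerI simp: W_x_def lookup_single when_def)
    moreover have "x_gen * x_gen \<in> (rel :: (gen, 'k) tensor set)"
      by (rule subsetD[OF tensor_span_closed(1)]) simp
    moreover have "W_x p = W_x i * (x_gen * x_gen) * W_x j"
      by (simp add: W_x_def basis_vector_mult2 mult_single plus_fword_def that[symmetric]
          replicate_add numeral_2_eq_2 replicate_app_Cons_same)
    ultimately have "W_x p \<in> ?G i j" by blast
    thus ?thesis by (rule subsetD[OF tensor_span_closed(1)])
  qed
  thus "{const a * W_x p | a :: 'k. True} \<subseteq> koszul_W rel p"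
    unfolding W by (auto intro!: tensor_span_closed(4))
qed

lemma tensor_power_0: "t \<in> tensor_power 0 \<longleftrightarrow> (\<exists>a. t = const a)" for t :: "(gen, 'k :: comm_ring_1) tensor"
proof
  assume t: "t \<in> tensor_power 0"
  have "t = const (Poly_Mapping.lookup t 0)"
  proof (rule poly_mapping_eqI)
    fix w :: "gen fword"
    obtain s where "w = FWord s" by (cases w)
    thus "Poly_Mapping.lookup t w = Poly_Mapping.lookup (const (Poly_Mapping.lookup t 0)) w"
      using tensor_power_lookup[OF t, of s] by (auto simp: lookup_single when_def zero_fword_def)
  qed
  thus "\<exists>a. t = const a" by blast
qed (auto intro!: tensor_powerI simp: lookup_single when_def zero_fword_def split: if_splits)

lemma koszul_W_rel:
  "koszul_W rel p = {const a * W_x p + const b * W_y p | a b :: 'k :: comm_ring_1. True}"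
proof -
  consider "p = 0" | "p = 1" | "p = 2" | "p \<ge> 3" by linarith
  thus ?thesis
  proof cases
    case 1
    have "W_x 0 = (1 :: (gen, 'k) tensor)"
      by (simp add: W_x_def zero_fword_def[symmetric])
    thus ?thesis by (auto simp: 1 koszul_W_def W_y_def tensor_power_0)
  next
    case 2
    have "t \<in> tensor_power 1 \<longleftrightarrow> (\<exists>a b. t = const a * W_x 1 + const b * W_y 1)" for t :: "(gen, 'k) tensor"
    proof
      assume t: "t \<in> tensor_power 1"
      have "t = const (Poly_Mapping.lookup t (FWord [X])) * W_x 1
          + const (Poly_Mapping.lookup t (FWord [Y])) * W_y 1" (is "t = ?t")
      proof (rule poly_mapping_eqI)
        fix w :: "gen fword"
        obtain s where w: "w = FWord s" by (cases w)
        show "Poly_Mapping.lookup t w = Poly_Mapping.lookup ?t w"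
        proof (cases "length s = 1")
          case True
          then obtain v where "s = [v]" by (auto simp: length_Suc_conv)
          thus ?thesis
            by (cases v) (auto simp: w W_x_def W_y_def basis_vector_def lookup_add lookup_single)
        next
          case False
          thus ?thesis using tensor_power_lookup[OF t]
            by (auto simp: w W_x_def W_y_def basis_vector_def lookup_add lookup_single when_def)
        qed
      qed
      thus "\<exists>a b. t = const a * W_x 1 + const b * W_y 1" by blast
    next
      assume "\<exists>a b. t = const a * W_x 1 + const b * W_y 1"
      thus "t \<in> tensor_power 1"
        by (auto intro!: tensor_powerI
            simp: W_x_def W_y_def basis_vector_def lookup_add lookup_single when_def)
    qed
    thus ?thesis by (auto simp: 2 koszul_W_def)
  next
    case 3
    \<comment> \<open>For \<open>p = 2\<close> the intersection has a single term, and its outer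
      factors are scalars, which leaves \<open>R\<close> itself.\<close>
    let ?G = "{a * r * b | a r b. a \<in> tensor_power 0 \<and> r \<in> rel \<and> b \<in> tensor_power 0}
      :: (gen, 'k) tensor set"
    have "koszul_W rel p = tensor_span ?G"
      by (simp add: 3 koszul_W_def)
    also have "\<dots> = rel"
    proof
      show "tensor_span ?G \<subseteq> rel"
      proof (rule tensor_span_least)
        show "?G \<subseteq> rel"
          by (auto simp: tensor_power_0 const_commute intro!: tensor_span_closed(4))
      qed (rule tensor_span_closed; assumption?)+
      have "1 \<in> (tensor_power 0 :: (gen, 'k) tensor set)"
        unfolding tensor_power_0 by (rule exI[of _ 1]) simp
      hence "1 * r * 1 \<in> ?G" if "r \<in> rel" for r
        using that by blast
      hence "rel \<subseteq> ?G" by auto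
      thus "rel \<subseteq> tensor_span ?G" using tensor_span_closed(1) by (rule subset_trans)
    qed
    also have "x_gen * x_gen = (W_x 2 :: (gen, 'k) tensor)"
      by (simp add: W_x_def basis_vector_mult2 numeral_2_eq_2)
    hence "rel = {const a * W_x 2 + const b * W_y 2 | a b :: 'k. True}"
      unfolding rel_eq by (simp add: W_y_def)
    finally show ?thesis using 3 by simp
  next
    case 4
    thus ?thesis by (simp add: koszul_W_ge_3 W_y_def)
  qed
qed

section \<open>The Koszul complex in coordinates\<close>

definition form_x :: "nat \<Rightarrow> (gen, 'k :: comm_ring_1) tensor \<Rightarrow> 'k" where
  "form_x p = dual_word (replicate p X)"

text \<open>The case distinction matters for \<open>p = 0\<close>: there the empty word would make
  this form coincide with \<open>form_x 0\<close>.\<close>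

definition form_y :: "nat \<Rightarrow> (gen, 'k :: comm_ring_1) tensor \<Rightarrow> 'k" where
  "form_y p w = (if p = 1 \<or> p = 2 then dual_word (replicate p Y) w else 0)"

lemma W_y_simps:
  "W_y (Suc 0) = Poly_Mapping.single (FWord [Y]) 1"
  "W_y 2 = Poly_Mapping.single (FWord [Y, Y]) 1 - Poly_Mapping.single (FWord [X, Y]) 1"
  "p \<noteq> Suc 0 \<Longrightarrow> p \<noteq> 2 \<Longrightarrow> W_y p = 0"
  by (simp_all add: W_y_def basis_vector_mult2) (simp add: basis_vector_def)

lemma form_comb [simp]:
  "form_x p (const a * W_x p + const b * W_y p) = a"
  "form_y p (const a * W_x p + const b * W_y p) = (if p = 1 \<or> p = 2 then b else 0)"
proof -
  have "replicate 2 z = [z, z]" for z :: gen by (simp add: numeral_2_eq_2)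
  note simps = this form_x_def form_y_def dual_word_def W_x_def W_y_simps lookup_add
    lookup_minus lookup_single when_def
  consider "p = 1" | "p = 2" | "p \<noteq> 1" "p \<noteq> 2" by blast
  hence "form_x p (const a * W_x p + const b * W_y p) = a
    \<and> form_y p (const a * W_x p + const b * W_y p) = (if p = 1 \<or> p = 2 then b else 0)"
    by cases (simp_all add: simps)
  thus "form_x p (const a * W_x p + const b * W_y p) = a"
    "form_y p (const a * W_x p + const b * W_y p) = (if p = 1 \<or> p = 2 then b else 0)"
    by blast+
qed

lemma form_linear:
  "form_x p (s + t) = form_x p s + form_x p t" "form_x p (const c * t) = c * form_x p t"
  "form_y p (s + t) = form_y p s + form_y p t" "form_y p (const c * t) = c * form_y p t"
  by (simp_all add: form_x_def form_y_def dual_word_def lookup_add)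

text \<open>
  The parameters are the values on \<^term>\<open>W_x p\<close> and \<^term>\<open>W_y p\<close>; since \<^term>\<open>W_y p\<close> is \<open>0\<close>
  unless \<open>p\<close> is 1 or 2, the second one has to be \<open>0\<close> in the other degrees.
\<close>

definition cochain :: "nat \<Rightarrow> 'k nf \<times> 'k nf \<Rightarrow> (gen, 'k :: comm_ring_1) tensor \<Rightarrow> (gen, 'k) tensor set" where
  "cochain p s = (\<lambda>w \<in> koszul_W rel p.
     nf_class (nf_scale (form_x p w) (fst s) + nf_scale (form_y p w) (snd s)))"

definition cochain_params :: "nat \<Rightarrow> ('k :: comm_ring_1 nf \<times> 'k nf) set" where
  "cochain_params p = {s. p = 1 \<or> p = 2 \<or> snd s = 0}"

abbreviation pair_scale :: "'k :: comm_ring_1 \<Rightarrow> 'k nf \<times> 'k nf \<Rightarrow> 'k nf \<times> 'k nf" where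
  "pair_scale c s \<equiv> (nf_scale c (fst s), nf_scale c (snd s))"

text \<open>When \<open>W_y p = 0\<close> the coefficient \<open>b\<close> is not determined by the
  argument; the formula still holds because then \<open>snd s = 0\<close>.\<close>

lemma cochain_apply:
  assumes "s \<in> cochain_params p"
  shows "cochain p s (const a * W_x p + const b * W_y p)
    = nf_class (nf_scale a (fst s) + nf_scale b (snd s))"
proof -
  have "const a * W_x p + const b * W_y p \<in> koszul_W rel p" unfolding koszul_W_rel by blast
  thus ?thesis using assms by (auto simp: cochain_def cochain_params_def)
qed

lemma inj_on_cochain: "inj_on (cochain p) (cochain_params p)"
proof (rule inj_onI)
  fix s t :: "'a nf \<times> 'a nf"
  assume st: "s \<in> cochain_params p" "t \<in> cochain_params p" "cochain p s = cochain p t"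
  have "nf_scale a (fst s) + nf_scale b (snd s) = nf_scale a (fst t) + nf_scale b (snd t)" for a b
    using cochain_apply[OF st(1), of a b] cochain_apply[OF st(2), of a b] st(3) by simp
  from this[of 1 0] this[of 0 1] show "s = t" by (simp add: prod_eq_iff)
qed

text \<open>A linear map is determined by its values on the two spanning elements of
  \<open>W_p\<close>, and these values are free except that the second must be 0 when
  \<open>W_y p = 0\<close>.\<close>

lemma koszul_cochains_simps:
  "carrier (koszul_cochains rel p) = cochain p ` (cochain_params p :: ('k nf \<times> 'k nf) set)"
  "\<zero>\<^bsub>koszul_cochains rel p\<^esub> = cochain p (0 :: 'k nf \<times> 'k nf)"
  "cochain p s \<oplus>\<^bsub>koszul_cochains rel p\<^esub> cochain p t = cochain p (s + t)"
  "c \<odot>\<^bsub>koszul_cochains rel p\<^esub> cochain p s = cochain p (pair_scale c s)"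
  for s t :: "'k :: comm_ring_1 nf \<times> 'k nf"
proof -
  let ?W = "koszul_W rel p :: (gen, 'k) tensor set"
  let ?H = "LinearCombinations.module_hom class_ring (tensor_algebra\<lparr>carrier := ?W\<rparr>) alg"
  have add: "s + t \<in> ?W" if st: "s \<in> ?W" "t \<in> ?W" for s t
  proof -
    from st obtain a b c d where "s = const a * W_x p + const b * W_y p"
      "t = const c * W_x p + const d * W_y p" unfolding koszul_W_rel by blast
    hence "s + t = const (a + c) * W_x p + const (b + d) * W_y p"
      by (simp add: single_add distrib_right)
    thus ?thesis unfolding koszul_W_rel by blast
  qed
  have smult: "const c * t \<in> ?W" if t: "t \<in> ?W" for c t
  proof -
    from t obtain a b where "t = const a * W_x p + const b * W_y p" unfolding koszul_W_rel by blast
    hence "const c * t = const (c * a) * W_x p + const (c * b) * W_y p"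
      by (simp add: distrib_left mult.assoc[symmetric] mult_single)
    thus ?thesis unfolding koszul_W_rel by blast
  qed
  have "?H \<inter> extensional ?W = cochain p ` cochain_params p"
  proof (intro equalityI subsetI)
    fix f assume f: "f \<in> ?H \<inter> extensional ?W"
    hence fW: "f w \<in> range nf_class" if "w \<in> ?W" for w
      using that by (auto simp: LinearCombinations.module_hom_def)
    have f_add: "f (s + t) = f s \<oplus>\<^bsub>alg\<^esub> f t" if "s \<in> ?W" "t \<in> ?W" for s t
      using f that by (auto simp: LinearCombinations.module_hom_def)
    have f_smult: "f (const c * t) = c \<odot>\<^bsub>alg\<^esub> f t" if "t \<in> ?W" for c t
      using f that by (auto simp: LinearCombinations.module_hom_def)
    have "const 1 * W_x p + const 0 * W_y p \<in> ?W" "const 0 * W_x p + const 1 * W_y p \<in> ?W"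
      unfolding koszul_W_rel by blast+
    hence W: "W_x p \<in> ?W" "W_y p \<in> ?W" by simp_all
    obtain a where a: "f (W_x p) = nf_class a" using fW[OF W(1)] by blast
    obtain b where b: "f (W_y p) = nf_class b" using fW[OF W(2)] by blast
    have p: "b = 0" if "\<not> (p = 1 \<or> p = 2)"
    proof -
      have "W_y p = (0 :: (gen, 'k) tensor)" using that by (simp add: W_y_def)
      thus ?thesis using b f_smult[OF W(2), of 0] by simp
    qed
    have "f = cochain p (a, b)"
    proof
      fix w
      show "f w = cochain p (a, b) w"
      proof (cases "w \<in> ?W")
        case True
        then obtain c d where w: "w = const c * W_x p + const d * W_y p"
          unfolding koszul_W_rel by blast
        have "f w = nf_class (nf_scale c a + nf_scale d b)"
          by (simp add: w f_add f_smult smult W a b)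
        thus ?thesis using p by (subst (2) w, subst cochain_apply) (auto simp: cochain_params_def)
      next
        case False
        thus ?thesis using f by (simp add: cochain_def extensional_def)
      qed
    qed
    moreover have "(a, b) \<in> cochain_params p" using p by (auto simp: cochain_params_def)
    ultimately show "f \<in> cochain p ` cochain_params p" by blast
  next
    fix f assume "f \<in> cochain p ` (cochain_params p :: ('k nf \<times> 'k nf) set)"
    then obtain s where "f = cochain p s" by blast
    thus "f \<in> ?H \<inter> extensional ?W"
      by (auto simp: LinearCombinations.module_hom_def cochain_def add smult form_linear nf_scale_add nf_scale_scale algebra_simps)
  qed
  thus "carrier (koszul_cochains rel p) = cochain p ` (cochain_params p :: ('k nf \<times> 'k nf) set)"
    by (simp add: koszul_cochains_def Let_def)
  show "\<zero>\<^bsub>koszul_cochains rel p\<^esub> = cochain p (0 :: 'k nf \<times> 'k nf)"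
    by (simp add: koszul_cochains_def Let_def cochain_def)
  show "cochain p s \<oplus>\<^bsub>koszul_cochains rel p\<^esub> cochain p t = cochain p (s + t)" for s t :: "'k nf \<times> 'k nf"
    by (auto simp: koszul_cochains_def Let_def cochain_def nf_scale_add algebra_simps intro!: restrict_ext)
  show "c \<odot>\<^bsub>koszul_cochains rel p\<^esub> cochain p s = cochain p (pair_scale c s)" for c and s :: "'k nf \<times> 'k nf"
    by (auto simp: koszul_cochains_def Let_def cochain_def nf_scale_add nf_scale_scale mult.commute intro!: restrict_ext)
qed

text \<open>
  On \<open>y\<^sup>2 - xy\<close> the differential is \<open>f(y)y - f(x)y + yf(y) - xf(y)\<close>.
\<close>

definition diff_params :: "nat \<Rightarrow> 'k :: comm_ring_1 nf \<times> 'k nf \<Rightarrow> 'k nf \<times> 'k nf" where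
  "diff_params p = (\<lambda>(a, b). (a * gen_nf X - nf_scale ((- 1) ^ p) (gen_nf X * a),
     if p = 0 then a * gen_nf Y - gen_nf Y * a
     else if p = 1 then b * gen_nf Y - a * gen_nf Y + gen_nf Y * b - gen_nf X * b
     else 0))"

section \<open>The differential in coordinates\<close>

lemma strip_linear:
  "strip_last v (s + t) = strip_last v s + strip_last v t"
  "strip_first v (s + t) = strip_first v s + strip_first v t"
  "strip_last v (const c * t) = const c * strip_last v t"
  "strip_first v (const c * t) = const c * strip_first v t"
  "strip_last v (s - t) = strip_last v s - strip_last v t"
  "strip_first v (s - t) = strip_first v s - strip_first v t"
  for s t :: "(gen, 'k :: comm_ring_1) tensor"
  by (auto intro!: poly_mapping_eqI
      simp: lookup_strip_last lookup_strip_first lookup_add lookup_minus)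

lemma strip_single:
  "strip_last v (Poly_Mapping.single (FWord (l @ [u])) c) =
     (if u = v then Poly_Mapping.single (FWord l) c else 0)"
  "strip_first v (Poly_Mapping.single (FWord (u # l)) c) =
     (if u = v then Poly_Mapping.single (FWord l) c else 0)"
  by (auto intro!: poly_mapping_eqI simp: lookup_strip_last lookup_strip_first lookup_single
      plus_fword_def when_def fword.expand)

lemma strip_0 [simp]: "strip_last v 0 = 0" "strip_first v 0 = 0"
  by (auto intro!: poly_mapping_eqI simp: lookup_strip_last lookup_strip_first)

lemma strip_W_x:
  "strip_last v (W_x (Suc p)) = (if v = X then W_x p else 0)"
  "strip_first v (W_x (Suc p)) = (if v = X then W_x p else 0)"
  using strip_single(1)[of v "replicate p X" X 1] strip_single(2)[of v X "replicate p X" 1]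
  by (auto simp: W_x_def replicate_append_same)

text \<open>In degree 2 this reads off the two factorisations \<open>(y - x)y\<close> and
  \<open>y * y - x * y\<close> of the relation.\<close>

lemma strip_W_y:
  "strip_last v (W_y (Suc p) :: (gen, 'k :: comm_ring_1) tensor) =
     (if v = Y \<and> p = 0 then W_x 0 else if v = Y \<and> p = 1 then W_y 1 - W_x 1 else 0)"
  "strip_first v (W_y (Suc p) :: (gen, 'k) tensor) =
     (if p = 0 then (if v = Y then W_x 0 else 0)
      else if p = 1 then (if v = Y then W_y 1 else - W_y 1) else 0)"
proof -
  note S = strip_single(1)[of v "[]" Y "1 :: 'k"] strip_single(1)[of v "[X]" Y "1 :: 'k"] strip_single(1)[of v "[Y]" Y "1 :: 'k"]
    strip_single(2)[of v Y "[]" "1 :: 'k"] strip_single(2)[of v X "[Y]" "1 :: 'k"] strip_single(2)[of v Y "[Y]" "1 :: 'k"]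
  have W_y_2: "(W_y (Suc (Suc 0)) :: (gen, 'k) tensor) = Poly_Mapping.single (FWord [Y, Y]) 1 - Poly_Mapping.single (FWord [X, Y]) 1"
    using W_y_simps(2) by (simp add: numeral_2_eq_2)
  consider "p = 0" | "p = 1" | "p > 1" by linarith
  hence "strip_last v (W_y (Suc p) :: (gen, 'k) tensor) =
     (if v = Y \<and> p = 0 then W_x 0 else if v = Y \<and> p = 1 then W_y 1 - W_x 1 else 0)
    \<and> strip_first v (W_y (Suc p) :: (gen, 'k) tensor) =
     (if p = 0 then (if v = Y then W_x 0 else 0)
      else if p = 1 then (if v = Y then W_y 1 else - W_y 1) else 0)"
  proof cases
    case 1
    thus ?thesis using S by (cases v) (simp_all add: W_y_simps(1) W_x_def)
  next
    case 2
    thus ?thesis using S by (cases v) (simp_all add: W_y_simps(1) W_y_2 W_x_def strip_linear)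
  next
    case 3
    thus ?thesis by (simp add: W_y_simps(3))
  qed
  thus "strip_last v (W_y (Suc p) :: (gen, 'k) tensor) =
     (if v = Y \<and> p = 0 then W_x 0 else if v = Y \<and> p = 1 then W_y 1 - W_x 1 else 0)"
    "strip_first v (W_y (Suc p) :: (gen, 'k) tensor) =
     (if p = 0 then (if v = Y then W_x 0 else 0)
      else if p = 1 then (if v = Y then W_y 1 else - W_y 1) else 0)"
    by blast+
qed

lemma koszul_diff_cochain:
  assumes s: "s \<in> cochain_params p"
  shows "koszul_diff rel p (cochain p s) = cochain (Suc p) (diff_params p s)"
proof -
  obtain a b where ab: "s = (a, b)" by (cases s)
  have "koszul_diff rel p (cochain p s) w = cochain (Suc p) (diff_params p s) w" for w
  proof (cases "w \<in> koszul_W rel (Suc p)")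
    case False
    thus ?thesis by (simp add: koszul_diff_def cochain_def Let_def)
  next
    case True
    then obtain c d where w: "w = const c * W_x (Suc p) + const d * W_y (Suc p)"
      unfolding koszul_W_rel by blast
    \<comment> \<open>\<open>L\<close> and \<open>F\<close> are the normal forms of the cochain on
      \<open>w\<close> stripped of its last and of its first letter.\<close>
    define L where "L v = (if v = X then nf_scale c a
       else if p = 0 then nf_scale d a else if p = 1 then nf_scale d (b - a) else 0)" for v
    define F where "F v = (if v = X then nf_scale c a - (if p = 1 then nf_scale d b else 0)
       else if p = 0 then nf_scale d a else if p = 1 then nf_scale d b else 0)" for v
    have L: "cochain p s (strip_last v w) = nf_class (L v)" for v
    proof -
      \<comment> \<open>The zero terms bring every branch into the shape required by
        \<open>cochain_apply\<close>.\<close>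
      have "strip_last v w = (if v = X then const c * W_x p + const 0 * W_y p
          else if p = 0 then const d * W_x p + const 0 * W_y p
          else if p = 1 then const (- d) * W_x p + const d * W_y p
          else const 0 * W_x p + const 0 * W_y p)"
        by (cases v) (simp_all add: w strip_linear strip_W_x strip_W_y algebra_simps)
      thus ?thesis
        by (simp only: if_distrib[of "cochain p s"] cochain_apply[OF s])
          (simp add: L_def ab nf_eq_iff algebra_simps)
    qed
    have F: "cochain p s (strip_first v w) = nf_class (F v)" for v
    proof -
      have "strip_first v w = (if v = X then const c * W_x p + const (if p = 1 then - d else 0) * W_y p
          else if p = 0 then const d * W_x p + const 0 * W_y p
          else if p = 1 then const 0 * W_x p + const d * W_y p
          else const 0 * W_x p + const 0 * W_y p)"
        by (cases v) (simp_all add: w strip_linear strip_W_x strip_W_y algebra_simps)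
      thus ?thesis
        by (simp only: if_distrib[of "cochain p s"] cochain_apply[OF s])
          (simp add: F_def ab nf_eq_iff algebra_simps)
    qed
    have "koszul_diff rel p (cochain p s) w = nf_class
      (L X * gen_nf X + L Y * gen_nf Y - nf_scale ((- 1) ^ p) (gen_nf X * F X + gen_nf Y * F Y))"
      using True by (simp add: koszul_diff_def Let_def L F quot_class_rel)
    also have "\<dots> = nf_class (nf_scale c (fst (diff_params p s)) + nf_scale d (snd (diff_params p s)))"
      by (simp add: L_def F_def diff_params_def ab nf_eq_iff algebra_simps)
    also have "\<dots> = cochain (Suc p) (diff_params p s) w"
      unfolding w by (rule cochain_apply[symmetric])
        (auto simp: cochain_params_def diff_params_def ab)
    finally show ?thesis .
  qed
  thus ?thesis by blast
qed

lemma diff_params_mem: "diff_params p s \<in> cochain_params (Suc p)"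
  by (cases s) (auto simp: cochain_params_def diff_params_def)

lemma diff_params_linear:
  "diff_params p (s + t) = diff_params p s + diff_params p t"
  "diff_params p (s - t) = diff_params p s - diff_params p t"
  "diff_params p (pair_scale c s) = pair_scale c (diff_params p s)"
  "diff_params p 0 = 0"
  by (auto simp: diff_params_def prod_eq_iff split_beta nf_eq_iff algebra_simps)

definition cocycle_params :: "nat \<Rightarrow> ('k :: comm_ring_1 nf \<times> 'k nf) set" where
  "cocycle_params p = {s \<in> cochain_params p. diff_params p s = 0}"

lemma koszul_cocycles_rel: "koszul_cocycles rel p = cochain p ` cocycle_params p"
proof -
  have "koszul_diff rel p (cochain p s) = \<zero>\<^bsub>koszul_cochains rel (Suc p)\<^esub> \<longleftrightarrow> diff_params p s = 0"
    if s: "s \<in> cochain_params p" for s :: "'a nf \<times> 'a nf"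
  proof -
    have "0 \<in> cochain_params (Suc p)" by (simp add: cochain_params_def)
    thus ?thesis
      using inj_on_eq_iff[OF inj_on_cochain diff_params_mem, of 0 p s]
      by (simp add: koszul_diff_cochain[OF s] koszul_cochains_simps)
  qed
  thus ?thesis
    by (auto simp: koszul_cocycles_def koszul_cochains_simps cocycle_params_def)
qed

lemma koszul_coboundaries_rel:
  "koszul_coboundaries rel 0 = cochain 0 ` {0}"
  "koszul_coboundaries rel (Suc p) = cochain (Suc p) ` diff_params p ` cochain_params p"
  by (auto simp: koszul_coboundaries_def koszul_cochains_simps koszul_diff_cochain image_iff)

text \<open>Reduces a degree to two checks on parameters: the forms cut out the coboundaries, and
  the proposed cocycles are dual to the forms.\<close>

lemma HK_generated:
  fixes \<psi> :: "'k :: field nf \<times> 'k nf \<Rightarrow> nat \<Rightarrow> 'k"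
  assumes \<psi>: "\<And>s t i. \<psi> (s + t) i = \<psi> s i + \<psi> t i" "\<And>c s i. \<psi> (pair_scale c s) i = c * \<psi> s i"
    and N: "koszul_coboundaries rel p = cochain p ` {s \<in> cocycle_params p. \<forall>i<n. \<psi> s i = 0}"
    and g: "\<And>i. i < n \<Longrightarrow> g i \<in> cocycle_params p"
      "\<And>i j. i < n \<Longrightarrow> j < n \<Longrightarrow> \<psi> (g i) j = (if i = j then 1 else 0)"
  shows "generated_with_dim (HK rel p) n ((\<lambda>i. HK_class rel p (cochain p (g i))) ` {..<n})"
proof -
  let ?M = "(koszul_cochains rel p)\<lparr>carrier := koszul_cocycles rel p\<rparr>"
  have "generated_with_dim (quotient_module ?M (koszul_coboundaries rel p)) n
    ((\<lambda>i. koszul_coboundaries rel p +>\<^bsub>?M\<^esub> cochain p (g i)) ` {..<n})"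
  proof (rule generated_with_dim_quotient[where S = "cocycle_params p" and \<psi> = \<psi> and sc = pair_scale])
    show "inj_on (cochain p) (cocycle_params p)"
      by (rule inj_on_subset[OF inj_on_cochain]) (auto simp: cocycle_params_def)
  qed (use \<psi> N g in \<open>auto simp: koszul_cocycles_rel koszul_cochains_simps cocycle_params_def
        cochain_params_def diff_params_linear zero_prod_def[symmetric]\<close>)
  thus ?thesis
    \<comment> \<open>Cosets depend only on addition, so restricting the carrier to cocycles does
      not change them.\<close>
    by (simp add: HK_def HK_class_def a_r_coset_def r_coset_def)
qed

lemma cochain_tensor_rel:
  "cochain_tensor rel p a (dual_word (replicate p X)) = cochain p (nf_of a, 0)"
  "p = 1 \<or> p = 2 \<Longrightarrow> cochain_tensor rel p a (dual_word (replicate p Y)) = cochain p (0, nf_of a)"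
  by (auto simp: cochain_tensor_def cochain_def form_x_def form_y_def quot_class_rel)

section \<open>The cohomology\<close>

lemma cocycle_params_0:
  "s \<in> cocycle_params 0 \<longleftrightarrow> snd s = 0 \<and> cx (fst s) = 0 \<and> cy (fst s) = 0 \<and> cxy (fst s) = 0
     \<and> cyx (fst s) = 0"
  by (cases s) (auto simp: cocycle_params_def cochain_params_def diff_params_def zero_prod_def nf_eq_iff)

text \<open>The anticommutator of \<open>x\<close> with the value on \<open>x\<close> has
  \<open>x\<close>-coefficient twice the constant term; characteristic zero makes that constant term
  vanish.\<close>

lemma cocycle_params_1:
  fixes s :: "'k :: field_char_0 nf \<times> 'k nf"
  shows "s \<in> cocycle_params 1 \<longleftrightarrow> cone (fst s) = 0 \<and> cy (fst s) = 0 \<and> cyx (fst s) = - cxy (fst s)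
     \<and> cone (snd s) = 0 \<and> cx (snd s) = 0 \<and> cy (snd s) = cx (fst s)"
  by (cases s) (auto simp: cocycle_params_def cochain_params_def diff_params_def zero_prod_def
      nf_eq_iff add_eq_0_iff)

text \<open>The value on \<open>y^2 - xy\<close> is unconstrained, because \<open>W_3\<close> is
  spanned by \<open>x^3\<close> alone. This separates degree 2 from the higher even degrees.\<close>

lemma cocycle_params_2:
  "s \<in> cocycle_params 2 \<longleftrightarrow> cy (fst s) = 0 \<and> cxy (fst s) = cyx (fst s)"
  by (cases s) (auto simp: cocycle_params_def cochain_params_def diff_params_def zero_prod_def
      nf_eq_iff)

lemma cocycle_params_even:
  "even p \<Longrightarrow> p \<ge> 3 \<Longrightarrow>
    s \<in> cocycle_params p \<longleftrightarrow> snd s = 0 \<and> cy (fst s) = 0 \<and> cxy (fst s) = cyx (fst s)"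
  by (cases s) (auto simp: cocycle_params_def cochain_params_def diff_params_def zero_prod_def
      nf_eq_iff)

lemma cocycle_params_odd:
  fixes s :: "'k :: field_char_0 nf \<times> 'k nf"
  shows "odd p \<Longrightarrow> p \<ge> 3 \<Longrightarrow>
    s \<in> cocycle_params p \<longleftrightarrow> snd s = 0 \<and> cone (fst s) = 0 \<and> cy (fst s) = 0
      \<and> cyx (fst s) = - cxy (fst s)"
  by (cases s) (auto simp: cocycle_params_def cochain_params_def diff_params_def zero_prod_def
      nf_eq_iff add_eq_0_iff)

text \<open>One inclusion is read off the coordinates of the differential; for the other, the linear
  equations are solved and the solution given as a witness, with components in the kernel chosen as
  0.\<close>

lemma image_diff_params:
  fixes s :: "'k :: field_char_0 nf \<times> 'k nf"
  shows "diff_params 0 ` cochain_params 0 =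
    {s :: 'k nf \<times> 'k nf. s \<in> cocycle_params 1 \<and> cx (fst s) = 0 \<and> cxy (snd s) + cyx (snd s) = 0}" (is "_ = ?B1")
    and "diff_params 1 ` cochain_params 1 =
    {s :: 'k nf \<times> 'k nf. s \<in> cocycle_params 2 \<and> cone (fst s) = 0 \<and> cone (snd s) = 0
       \<and> cy (snd s) + 2 * cx (snd s) + cx (fst s) / 2 = 0 \<and> cxyx (snd s) = 0}" (is "_ = ?B2")
    and "even p \<Longrightarrow> p \<ge> 2 \<Longrightarrow> diff_params p ` cochain_params p =
    {s :: 'k nf \<times> 'k nf. s \<in> cocycle_params (Suc p) \<and> cx (fst s) = 0}"
    and "odd p \<Longrightarrow> p \<ge> 2 \<Longrightarrow> diff_params p ` cochain_params p =
    {s :: 'k nf \<times> 'k nf. s \<in> cocycle_params (Suc p) \<and> cone (fst s) = 0}"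
proof -
  show "diff_params 0 ` cochain_params 0 = ?B1"
  proof (intro equalityI subsetI)
    fix s assume "s \<in> ?B1"
    hence "s = diff_params 0 (NF 0 (cxy (snd s)) (- cxy (fst s)) (cxyx (fst s) - cxyx (snd s))
        (- cxyx (snd s)) 0, 0)"
      unfolding cocycle_params_1
      by (auto simp: diff_params_def prod_eq_iff nf_eq_iff add_eq_0_iff)
    thus "s \<in> diff_params 0 ` cochain_params 0"
      by (rule image_eqI) (simp add: cochain_params_def)
  next
    fix s assume "s \<in> diff_params 0 ` (cochain_params 0 :: ('k nf \<times> 'k nf) set)"
    thus "s \<in> ?B1" unfolding cocycle_params_1
      by (auto simp: diff_params_def cochain_params_def)
  qed
  show "diff_params 1 ` cochain_params 1 = ?B2"
  proof (intro equalityI subsetI)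
    fix s assume s: "s \<in> ?B2"
    have "cy (snd s) = (cy (snd s) + 2 * cx (snd s) + cx (fst s) / 2) - 2 * cx (snd s) - cx (fst s) / 2"
      by simp
    also have "cy (snd s) + 2 * cx (snd s) + cx (fst s) / 2 = 0" using s by blast
    finally have "cy (snd s) = - 2 * cx (snd s) - cx (fst s) / 2" by simp
    \<comment> \<open>Constant terms are recovered from \<open>cx (fst s) = 2 * cone a\<close> and
      \<open>cx (snd s) = - cone b\<close>; the identity just derived is the remaining compatibility
      at \<open>y\<close>. The \<open>x\<close>-coefficient of \<open>a\<close> is set to 0, which
      fixes the \<open>y\<close>-coefficient of \<open>b\<close>.\<close>
    hence "s = diff_params 1
        (NF (cx (fst s) / 2) 0 (cxy (fst s)) (cxyx (fst s)) 0 0,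
         NF (- cx (snd s)) (cyx (snd s)) (cxy (snd s) - cyx (snd s) + cxy (fst s)) 0 0 0)"
      using s unfolding cocycle_params_2
      by (auto simp: diff_params_def prod_eq_iff nf_eq_iff)
    thus "s \<in> diff_params 1 ` cochain_params 1"
      by (rule image_eqI) (simp add: cochain_params_def)
  next
    fix s assume "s \<in> diff_params 1 ` (cochain_params 1 :: ('k nf \<times> 'k nf) set)"
    thus "s \<in> ?B2" unfolding cocycle_params_2
      by (auto simp: diff_params_def cochain_params_def field_simps)
  qed
  show "diff_params p ` cochain_params p =
    {s :: 'k nf \<times> 'k nf. s \<in> cocycle_params (Suc p) \<and> cx (fst s) = 0}" (is "_ = ?B") if p: "even p" "p \<ge> 2"
  proof (intro equalityI subsetI)
    fix s assume s: "s \<in> ?B"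
    have "s = diff_params p (NF 0 0 (- cxy (fst s)) (cxyx (fst s)) 0 0, 0)"
      using s p cocycle_params_odd[of "Suc p" s]
      by (auto simp: diff_params_def prod_eq_iff nf_eq_iff)
    thus "s \<in> diff_params p ` cochain_params p"
      by (rule image_eqI) (simp add: cochain_params_def)
  next
    fix s assume "s \<in> diff_params p ` (cochain_params p :: ('k nf \<times> 'k nf) set)"
    thus "s \<in> ?B" using p cocycle_params_odd[of "Suc p" s]
      by (auto simp: diff_params_def cochain_params_def nf_eq_iff)
  qed
  show "diff_params p ` cochain_params p =
    {s :: 'k nf \<times> 'k nf. s \<in> cocycle_params (Suc p) \<and> cone (fst s) = 0}" (is "_ = ?B") if p: "odd p" "p \<ge> 2"
  proof (intro equalityI subsetI)
    fix s assume s: "s \<in> ?B"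
    \<comment> \<open>The anticommutator with \<open>x\<close> sends \<open>1\<close> to
      \<open>2x\<close>, \<open>y\<close> to \<open>xy + yx\<close> and \<open>xy\<close> to
      \<open>xyx\<close>.\<close>
    have "s = diff_params p (NF (cx (fst s) / 2) 0 (cxy (fst s)) (cxyx (fst s)) 0 0, 0)"
      using s p cocycle_params_even[of "Suc p" s]
      by (auto simp: diff_params_def prod_eq_iff nf_eq_iff)
    thus "s \<in> diff_params p ` cochain_params p"
      by (rule image_eqI) (simp add: cochain_params_def)
  next
    fix s assume "s \<in> diff_params p ` (cochain_params p :: ('k nf \<times> 'k nf) set)"
    thus "s \<in> ?B" using p cocycle_params_even[of "Suc p" s]
      by (auto simp: diff_params_def cochain_params_def nf_eq_iff)
  qed
qed

lemma nf_of_gen_word [simp]: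
  "nf_of (x_gen * y_gen) = NF 0 0 0 1 0 0" "nf_of (x_gen * y_gen * x_gen) = NF 0 0 0 0 0 1"
  by (simp_all add: nf_of_mult nf_eq_iff)

lemma HK_0:
  "generated_with_dim (HK rel 0) 2
     {HK_class rel 0 (cochain 0 (1 :: 'k :: field_char_0 nf, 0)),
      HK_class rel 0 (cochain 0 (NF 0 0 0 0 0 1, 0))}"
proof -
  define g :: "nat \<Rightarrow> 'k nf \<times> 'k nf" where "g i = (if i = 0 then 1 else NF 0 0 0 0 0 1, 0)" for i
  define \<psi> :: "'k nf \<times> 'k nf \<Rightarrow> nat \<Rightarrow> 'k" where
    "\<psi> s i = (if i = 0 then cone (fst s) else cxyx (fst s))" for s i
  have "generated_with_dim (HK rel 0) 2 ((\<lambda>i. HK_class rel 0 (cochain 0 (g i))) ` {..<2})"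
  proof (rule HK_generated[where \<psi> = \<psi>])
    have "{0} = {s :: 'k nf \<times> 'k nf. s \<in> cocycle_params 0 \<and> (\<forall>i<2. \<psi> s i = 0)}"
      by (auto simp: cocycle_params_0 \<psi>_def prod_eq_iff nf_eq_iff numeral_2_eq_2 All_less_Suc)
    thus "koszul_coboundaries rel 0 = cochain 0 ` {s \<in> cocycle_params 0. \<forall>i<2. \<psi> s i = 0}"
      by (simp only: koszul_coboundaries_rel(1))
  qed (auto simp: \<psi>_def g_def cocycle_params_0 numeral_2_eq_2 less_Suc_eq)
  thus ?thesis by (simp add: g_def numeral_2_eq_2 lessThan_Suc insert_commute)
qed

lemma HK_1:
  "generated_with_dim (HK rel 1) 2
     {HK_class rel 1 (cochain 1 (gen_nf X :: 'k :: field_char_0 nf, gen_nf Y)),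
      HK_class rel 1 (cochain 1 (0, NF 0 0 0 1 0 0))}"
proof -
  define g :: "nat \<Rightarrow> 'k nf \<times> 'k nf" where
    "g i = (if i = 0 then (gen_nf X, gen_nf Y) else (0, NF 0 0 0 1 0 0))" for i
  define \<psi> :: "'k nf \<times> 'k nf \<Rightarrow> nat \<Rightarrow> 'k" where
    \<comment> \<open>The commutator of any element with \<open>y\<close> is a multiple of
      \<open>xy - yx\<close> plus a multiple of \<open>xyx\<close>, so the sum of the two
      coefficients vanishes on coboundaries.\<close>
    "\<psi> s i = (if i = 0 then cx (fst s) else cxy (snd s) + cyx (snd s))" for s i
  have "generated_with_dim (HK rel 1) 2 ((\<lambda>i. HK_class rel 1 (cochain 1 (g i))) ` {..<2})"
  proof (rule HK_generated[where \<psi> = \<psi>])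
    have "koszul_coboundaries rel 1 = cochain 1 ` diff_params 0 ` (cochain_params 0 :: ('k nf \<times> 'k nf) set)"
      using koszul_coboundaries_rel(2)[of 0] by simp
    also have "\<dots> = cochain 1 ` {s \<in> cocycle_params 1. \<forall>i<2. \<psi> s i = 0}"
      unfolding image_diff_params(1)
      by (rule arg_cong[where f = "image _"]) (auto simp: \<psi>_def numeral_2_eq_2 All_less_Suc)
    finally show "koszul_coboundaries rel 1 = cochain 1 ` {s \<in> cocycle_params 1. \<forall>i<2. \<psi> s i = 0}" .
  next
    fix i :: nat
    show "g i \<in> cocycle_params 1" unfolding cocycle_params_1 by (simp add: g_def)
  qed (auto simp: \<psi>_def g_def numeral_2_eq_2 less_Suc_eq algebra_simps)
  thus ?thesis by (simp add: g_def numeral_2_eq_2 lessThan_Suc insert_commute)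
qed

lemma HK_2:
  "generated_with_dim (HK rel 2) 4
     {HK_class rel 2 (cochain 2 (1 :: 'k :: field_char_0 nf, 0)),
      HK_class rel 2 (cochain 2 (0, 1)),
      HK_class rel 2 (cochain 2 (0, gen_nf Y)),
      HK_class rel 2 (cochain 2 (0, NF 0 0 0 0 0 1))}"
proof -
  define g :: "nat \<Rightarrow> 'k nf \<times> 'k nf" where
    "g i = (if i = 0 then (1, 0) else if i = 1 then (0, 1) else if i = 2 then (0, gen_nf Y)
      else (0, NF 0 0 0 0 0 1))" for i
  define \<psi> :: "'k nf \<times> 'k nf \<Rightarrow> nat \<Rightarrow> 'k" where
    \<comment> \<open>The third form eliminates the constant terms: a coboundary of
      \<open>(a, b)\<close> has \<open>cx (fst s) = 2 * cone a\<close>,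
      \<open>cx (snd s) = - cone b\<close> and
      \<open>cy (snd s) = 2 * cone b - cone a\<close>.\<close>
    "\<psi> s i = (if i = 0 then cone (fst s) else if i = 1 then cone (snd s)
      else if i = 2 then cy (snd s) + 2 * cx (snd s) + cx (fst s) / 2 else cxyx (snd s))" for s i
  have four: "{..<4 :: nat} = {0, 1, 2, 3}" by auto
  have "(\<forall>i<4 :: nat. P i) \<longleftrightarrow> (\<forall>i\<in>{..<4}. P i)" for P
    by (simp add: Ball_def)
  hence All_4: "(\<forall>i<4 :: nat. P i) \<longleftrightarrow> P 0 \<and> P 1 \<and> P 2 \<and> P 3" for P
    unfolding four by simp
  have "generated_with_dim (HK rel 2) 4 ((\<lambda>i. HK_class rel 2 (cochain 2 (g i))) ` {..<4})"
  proof (rule HK_generated[where \<psi> = \<psi>])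
    have "koszul_coboundaries rel 2 = cochain 2 ` diff_params 1 ` (cochain_params 1 :: ('k nf \<times> 'k nf) set)"
      using koszul_coboundaries_rel(2)[of 1] by (simp add: numeral_2_eq_2)
    also have "\<dots> = cochain 2 ` {s \<in> cocycle_params 2. \<forall>i<4. \<psi> s i = 0}"
      unfolding image_diff_params(2)
      by (rule arg_cong[where f = "image _"]) (auto simp: \<psi>_def All_4)
    finally show "koszul_coboundaries rel 2 = cochain 2 ` {s \<in> cocycle_params 2. \<forall>i<4. \<psi> s i = 0}" .
  next
    fix i j :: nat
    show "g i \<in> cocycle_params 2" unfolding cocycle_params_2 by (simp add: g_def)
    assume "i < 4" "j < 4"
    hence "i \<in> {0, 1, 2, 3}" "j \<in> {0, 1, 2, 3}" by auto
    thus "\<psi> (g i) j = (if i = j then 1 else 0)" by (auto simp: \<psi>_def g_def)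
  qed (auto simp: \<psi>_def field_simps)
  thus ?thesis by (simp add: g_def four)
qed

lemma HK_ge_3:
  assumes p: "p \<ge> 3"
  shows "generated_with_dim (HK rel p) 1
     {HK_class rel p (cochain p (if odd p then gen_nf X else 1 :: 'k :: field_char_0 nf, 0))}"
proof -
  define g :: "nat \<Rightarrow> 'k nf \<times> 'k nf" where "g i = (if odd p then gen_nf X else 1, 0)" for i
  \<comment> \<open>In odd degrees coboundaries are commutators with \<open>x\<close>, which have no
    \<open>x\<close>-coefficient; in even degrees they are anticommutators, which have no constant
    term.\<close>
  define \<psi> :: "'k nf \<times> 'k nf \<Rightarrow> nat \<Rightarrow> 'k" where
    "\<psi> s i = (if odd p then cx (fst s) else cone (fst s))" for s i
  obtain q where q: "p = Suc q" "q \<ge> 2" using p by (cases p) auto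
  have "generated_with_dim (HK rel p) 1 ((\<lambda>i. HK_class rel p (cochain p (g i))) ` {..<1})"
  proof (rule HK_generated[where \<psi> = \<psi>])
    have "diff_params q ` cochain_params q = {s \<in> cocycle_params p. \<forall>i<1. \<psi> s i = 0}"
      using image_diff_params(3,4)[of q] q by (cases "even q") (auto simp: \<psi>_def)
    thus "koszul_coboundaries rel p = cochain p ` {s \<in> cocycle_params p. \<forall>i<1. \<psi> s i = 0}"
      by (simp add: q koszul_coboundaries_rel(2))
  next
    fix i :: nat
    show "g i \<in> cocycle_params p"
      using p by (cases "odd p") (simp_all add: cocycle_params_odd cocycle_params_even g_def)
  qed (auto simp: \<psi>_def g_def)
  thus ?thesis by (simp add: g_def lessThan_Suc)
qed

theorem proposition9p5:
  fixes x y :: "(gen, 'k :: field_char_0) tensor"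
    and R :: "(gen, 'k) tensor set"
  assumes "x = basis_vector X" and "y = basis_vector Y"
    and "R = tensor_span {x * x, y * y - x * y}"
  shows
    "generated_with_dim (HK R 0) 2
       {HK_class R 0 (cochain_tensor R 0 1 (dual_word [])),
        HK_class R 0 (cochain_tensor R 0 (x * y * x) (dual_word []))}
     \<and>
     cochain_tensor R 1 x (dual_word [X]) \<oplus>\<^bsub>koszul_cochains R 1\<^esub> cochain_tensor R 1 y (dual_word [Y])
       = (\<lambda>v \<in> tensor_power 1. quot_class R v)
     \<and>
     generated_with_dim (HK R 1) 2
       {HK_class R 1 (cochain_tensor R 1 x (dual_word [X])
          \<oplus>\<^bsub>koszul_cochains R 1\<^esub> cochain_tensor R 1 y (dual_word [Y])),
        HK_class R 1 (cochain_tensor R 1 (x * y) (dual_word [Y]))}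
     \<and>
     generated_with_dim (HK R 2) 4
       {HK_class R 2 (cochain_tensor R 2 1 (dual_word [X, X])),
        HK_class R 2 (cochain_tensor R 2 1 (dual_word [Y, Y])),
        HK_class R 2 (cochain_tensor R 2 y (dual_word [Y, Y])),
        HK_class R 2 (cochain_tensor R 2 (x * y * x) (dual_word [Y, Y]))}
     \<and>
     (\<forall>p \<ge> 3.
       generated_with_dim (HK R p) 1
         {HK_class R p (cochain_tensor R p (if odd p then x else 1) (dual_word (replicate p X)))})"
proof -
  have R: "R = rel" using assms by simp
  \<comment> \<open>The replicated words are expanded to the explicit lists \<open>[]\<close>,
    \<open>[X]\<close>, \<open>[X, X]\<close> and their analogues in \<open>Y\<close>; for degree 2
    the numeral is unfolded to evaluate \<open>replicate\<close> and then restored as the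
    degree.\<close>
  note tensors =
    cochain_tensor_rel(1)[of 0, simplified] cochain_tensor_rel(1)[of 1, simplified]
    cochain_tensor_rel(2)[of 1, simplified]
    cochain_tensor_rel(1)[of 2, unfolded numeral_2_eq_2 replicate.simps, folded numeral_2_eq_2]
    cochain_tensor_rel(2)[of 2, unfolded numeral_2_eq_2 replicate.simps, folded numeral_2_eq_2, simplified]
  have e: "cochain_tensor R 1 x (dual_word [X]) \<oplus>\<^bsub>koszul_cochains R 1\<^esub> cochain_tensor R 1 y (dual_word [Y])
      = cochain 1 (gen_nf X, gen_nf Y)"
    unfolding R assms(1,2) by (simp add: tensors koszul_cochains_simps)
  have "cochain 1 (gen_nf X, gen_nf Y) = (\<lambda>v \<in> koszul_W rel 1. quot_class rel v :: (gen, 'k) tensor set)"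
  proof
    fix w
    have mem: "(gen_nf X, gen_nf Y) \<in> cochain_params 1" by (simp add: cochain_params_def)
    show "cochain 1 (gen_nf X, gen_nf Y) w
        = (\<lambda>v \<in> koszul_W rel 1. quot_class rel v :: (gen, 'k) tensor set) w"
    proof (cases "w \<in> koszul_W rel 1")
      case True
      then obtain a b where w: "w = const a * W_x 1 + const b * W_y 1"
        unfolding koszul_W_rel by blast
      have "nf_of w = nf_scale a (gen_nf X) + nf_scale b (gen_nf Y)"
        by (simp add: w nf_of_add nf_of_const_mult nf_of_single W_x_def W_y_def word_nf_def)
      hence "quot_class rel w = cochain 1 (gen_nf X, gen_nf Y) w"
        using cochain_apply[OF mem, of a b] by (simp add: quot_class_rel w)
      thus ?thesis using True by simp
    qed (simp add: cochain_def)
  qed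
  also have "koszul_W rel 1 = (tensor_power 1 :: (gen, 'k) tensor set)"
    by (simp add: koszul_W_def)
  finally have "cochain 1 (gen_nf X, gen_nf Y)
      = (\<lambda>v \<in> tensor_power 1. quot_class rel v :: (gen, 'k) tensor set)" .
  moreover have "odd p \<Longrightarrow> 3 \<le> p \<Longrightarrow>
      generated_with_dim (HK rel p) 1 {HK_class rel p (cochain p (gen_nf X :: 'k nf, 0))}"
    "even p \<Longrightarrow> 3 \<le> p \<Longrightarrow>
      generated_with_dim (HK rel p) 1 {HK_class rel p (cochain p (1 :: 'k nf, 0))}" for p
    using HK_ge_3[of p, where 'k = 'k] by auto
  ultimately show ?thesis
    unfolding e using HK_0[where 'k = 'k] HK_1[where 'k = 'k] HK_2[where 'k = 'k]
    unfolding R assms(1,2) by (simp add: tensors cochain_tensor_rel(1) if_distrib[of nf_of])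
qed

end
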